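(* Let $\Phi$ be an irreducible root system of rank $\ell$ with Coxeter number $h$. Then for every integer $q>h$, $$q^\ell=\big(E_\Phi(S)\,L_{\bar A}\big)(q),$$ i.e. if $E_\Phi(t)=\sum_i a_it^i$ then $q^\ell=\sum_i a_iL_{\bar A}(q-i)$.
   Context: Let $V=\mathbb{R}^\ell$ with inner product $(\cdot,\cdot)$, $\Phi\subset V$ an irreducible crystallographic root system of rank $\ell$ with Weyl group $W$, positive system $\Phi^+$, simple roots $\alpha_1,\dots,\alpha_\ell$ and Coxeter number $h$. Write the highest root as $\tilde\alpha=\sum_{i=1}^\ell c_i\alpha_i$ ($c_i\in\mathbb{Z}_{>0}$), and set $\alpha_0=-\tilde\alpha$, $c_0=1$. Coweight lattice $Z(\Phi)=\{x\mid(\alpha_i,x)\in\mathbb{Z}\ \forall i\}$; coroot lattice $\check Q(\Phi)=\sum_{\alpha\in\Phi}\mathbb{Z}\frac{2\alpha}{(\alpha,\alpha)}$; $f=\#Z(\Phi)/\check Q(\Phi)$. Fundamental alcove $A^\circ=\{x\mid(\alpha_i,x)>0\ (1\le i\le\ell),\ (\tilde\alpha,x)<1\}$ with closure $\bar A$; $L_{\bar A}(q)=\#(q\bar A\cap Z(\Phi))$, a quasi-polynomial in $q$ (extended to all integers). For $w\in W$, $\mathrm{asc}(w)=\sum_{0\le i\le\ell,\ w(\alpha_i)\in\Phi^+}c_i$; the generalized Eulerian polynomial is $E_\Phi(t)=\frac1f\sum_{w\in W}t^{\mathrm{asc}(w)}$. The shift operator acts by $(\sum_ka_kS^k)g(t)=\sum_ka_kg(t-k)$.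 *)

theory Defs
  imports "HOL-Analysis.Analysis" "HOL-Computational_Algebra.Polynomial"
begin

text \<open>
  The ambient space \<open>V\<close> is a Euclidean space \<open>'a\<close>, and the rank of a root system spanning it is
  \<open>DIM('a)\<close>. Simple roots are given as a family \<open>\<alpha> 1, \<dots>, \<alpha> DIM('a)\<close>. The notions below that take
  \<open>\<alpha>\<close> ignore the value \<open>\<alpha> 0\<close>, which is reserved for the negative of the highest root; the
  exception is \<open>asc\<close>, which uses it.
\<close>

definition reflection :: "'a::euclidean_space \<Rightarrow> 'a \<Rightarrow> 'a" where
  "reflection \<beta> x = x - (2 * (\<beta> \<bullet> x) / (\<beta> \<bullet> \<beta>)) *\<^sub>R \<beta>"

text \<open>Root systems are reduced.\<close>

definition crystallographic_root_system :: "'a::euclidean_space set \<Rightarrow> bool" where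
  "crystallographic_root_system \<Phi> \<longleftrightarrow>
     finite \<Phi> \<and> 0 \<notin> \<Phi> \<and> span \<Phi> = UNIV \<and>
     (\<forall>\<beta>\<in>\<Phi>. \<forall>k::real. k *\<^sub>R \<beta> \<in> \<Phi> \<longrightarrow> k = 1 \<or> k = -1) \<and>
     (\<forall>\<beta>\<in>\<Phi>. reflection \<beta> ` \<Phi> = \<Phi>) \<and>
     (\<forall>\<beta>\<in>\<Phi>. \<forall>\<gamma>\<in>\<Phi>. 2 * (\<beta> \<bullet> \<gamma>) / (\<beta> \<bullet> \<beta>) \<in> \<int>)"

definition irreducible_root_system :: "'a::euclidean_space set \<Rightarrow> bool" where
  "irreducible_root_system \<Phi> \<longleftrightarrow>
     crystallographic_root_system \<Phi> \<and>
     \<not> (\<exists>A B. A \<noteq> {} \<and> B \<noteq> {} \<and> A \<inter> B = {} \<and> \<Phi> = A \<union> B \<and> (\<forall>\<beta>\<in>A. \<forall>\<gamma>\<in>B. \<beta> \<bullet> \<gamma> = 0))"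

inductive_set weyl_group :: "'a::euclidean_space set \<Rightarrow> ('a \<Rightarrow> 'a) set" for \<Phi> where
  id: "id \<in> weyl_group \<Phi>"
| refl: "w \<in> weyl_group \<Phi> \<Longrightarrow> \<beta> \<in> \<Phi> \<Longrightarrow> reflection \<beta> \<circ> w \<in> weyl_group \<Phi>"

definition nonneg_comb :: "(nat \<Rightarrow> 'a::euclidean_space) \<Rightarrow> 'a \<Rightarrow> bool" where
  "nonneg_comb \<alpha> x \<longleftrightarrow> (\<exists>n::nat \<Rightarrow> nat. x = (\<Sum>i=1..DIM('a). real (n i) *\<^sub>R \<alpha> i))"

definition simple_roots :: "'a::euclidean_space set \<Rightarrow> (nat \<Rightarrow> 'a) \<Rightarrow> bool" where
  "simple_roots \<Phi> \<alpha> \<longleftrightarrow>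
     \<alpha> ` {1..DIM('a)} \<subseteq> \<Phi> \<and> inj_on \<alpha> {1..DIM('a)} \<and> independent (\<alpha> ` {1..DIM('a)}) \<and>
     (\<forall>\<beta>\<in>\<Phi>. nonneg_comb \<alpha> \<beta> \<or> nonneg_comb \<alpha> (- \<beta>))"

definition positive_roots :: "'a::euclidean_space set \<Rightarrow> (nat \<Rightarrow> 'a) \<Rightarrow> 'a set" where
  "positive_roots \<Phi> \<alpha> = {\<beta>\<in>\<Phi>. nonneg_comb \<alpha> \<beta>}"

definition highest_root :: "'a::euclidean_space set \<Rightarrow> (nat \<Rightarrow> 'a) \<Rightarrow> 'a \<Rightarrow> bool" where
  "highest_root \<Phi> \<alpha> \<theta> \<longleftrightarrow> \<theta> \<in> \<Phi> \<and> (\<forall>\<beta>\<in>\<Phi>. nonneg_comb \<alpha> (\<theta> - \<beta>))"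

definition coxeter_element :: "(nat \<Rightarrow> 'a) \<Rightarrow> 'a::euclidean_space \<Rightarrow> 'a" where
  "coxeter_element \<alpha> = foldr (\<lambda>i w. reflection (\<alpha> i) \<circ> w) [1..<Suc DIM('a)] id"

text \<open>The Coxeter number is the order of a Coxeter element.\<close>

definition coxeter_number :: "(nat \<Rightarrow> 'a::euclidean_space) \<Rightarrow> nat" where
  "coxeter_number \<alpha> = (LEAST n. n > 0 \<and> coxeter_element \<alpha> ^^ n = id)"

definition coweight_lattice :: "(nat \<Rightarrow> 'a::euclidean_space) \<Rightarrow> 'a set" where
  "coweight_lattice \<alpha> = {x. \<forall>i\<in>{1..DIM('a)}. \<alpha> i \<bullet> x \<in> \<int>}"

definition coroot_lattice :: "'a::euclidean_space set \<Rightarrow> 'a set" where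
  "coroot_lattice \<Phi> =
     {x. \<exists>n::'a \<Rightarrow> int. x = (\<Sum>\<beta>\<in>\<Phi>. of_int (n \<beta>) *\<^sub>R ((2 / (\<beta> \<bullet> \<beta>)) *\<^sub>R \<beta>))}"

definition connection_index :: "'a::euclidean_space set \<Rightarrow> (nat \<Rightarrow> 'a) \<Rightarrow> nat" where
  "connection_index \<Phi> \<alpha> =
     card (coweight_lattice \<alpha> // {(x, y). x \<in> coweight_lattice \<alpha> \<and> y \<in> coweight_lattice \<alpha> \<and>
                                          x - y \<in> coroot_lattice \<Phi>})"

definition fundamental_alcove :: "(nat \<Rightarrow> 'a) \<Rightarrow> 'a \<Rightarrow> 'a::euclidean_space set" where
  "fundamental_alcove \<alpha> \<theta> = {x. (\<forall>i\<in>{1..DIM('a)}. \<alpha> i \<bullet> x > 0) \<and> \<theta> \<bullet> x < 1}"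

definition quasi_polynomial :: "(int \<Rightarrow> real) \<Rightarrow> bool" where
  "quasi_polynomial g \<longleftrightarrow>
     (\<exists>N::nat. N > 0 \<and> (\<exists>p::int \<Rightarrow> real poly. \<forall>t. g t = poly (p (t mod int N)) (of_int t)))"

text \<open>
  The Ehrhart quasi-polynomial counts the points of \<open>Z\<close> in the dilate \<open>q P\<close> for \<open>q > 0\<close>; since a
  quasi-polynomial is determined by its values at the positive integers, this fixes the extension
  to all integers. (At \<open>q < 0\<close> it does not count points of \<open>q P\<close>.)
\<close>

definition ehrhart_quasi_polynomial :: "'a::euclidean_space set \<Rightarrow> 'a set \<Rightarrow> int \<Rightarrow> real" where
  "ehrhart_quasi_polynomial P Z =
     (THE L. quasi_polynomial L \<and>
             (\<forall>q::nat. q > 0 \<longrightarrow> L (int q) = real (card ((\<lambda>x. real q *\<^sub>R x) ` P \<inter> Z))))"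

definition asc ::
    "'a::euclidean_space set \<Rightarrow> (nat \<Rightarrow> 'a) \<Rightarrow> (nat \<Rightarrow> nat) \<Rightarrow> ('a \<Rightarrow> 'a) \<Rightarrow> nat" where
  "asc \<Phi> \<alpha> c w = (\<Sum>i | i \<in> {0..DIM('a)} \<and> w (\<alpha> i) \<in> positive_roots \<Phi> \<alpha>. c i)"

definition eulerian_poly ::
    "'a::euclidean_space set \<Rightarrow> (nat \<Rightarrow> 'a) \<Rightarrow> (nat \<Rightarrow> nat) \<Rightarrow> real poly" where
  "eulerian_poly \<Phi> \<alpha> c =
     smult (1 / real (connection_index \<Phi> \<alpha>)) (\<Sum>w\<in>weyl_group \<Phi>. monom 1 (asc \<Phi> \<alpha> c w))"

text \<open>\<open>shift_apply p g\<close> is \<open>p(S) g\<close>, where \<open>S\<close> is the shift \<open>(S g)(t) = g (t - 1)\<close>.\<close>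

definition shift_apply :: "real poly \<Rightarrow> (int \<Rightarrow> real) \<Rightarrow> int \<Rightarrow> real" where
  "shift_apply p g t = (\<Sum>k\<le>degree p. coeff p k * g (t - int k))"

end

theory Submission
  imports Defs
begin

text \<open>
  Let \<open>Z\<close> be the coweight lattice, \<open>Q\<close> the coroot lattice and \<open>f = [Z : Q]\<close>. Both sides of the identity
  are quasi-polynomials in \<open>q\<close>, so it is enough to treat large \<open>q\<close>, where only numbers of lattice points
  occur. There \<open>L (q - asc w)\<close> counts the \<open>x \<in> Z\<close> in the closed dilated alcove such that \<open>w (\<alpha> i)\<close> is
  negative for every wall \<open>i\<close> through \<open>x\<close>. The map \<open>(w, x) \<mapsto> w x\<close> from these pairs to \<open>Z / q Q\<close> is a
  bijection: for \<open>z \<in> Z\<close> and small \<open>\<epsilon> > 0\<close>, the point \<open>z - \<epsilon> \<rho>\<close> lies in the interior of exactly one image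
  of the dilated alcove under \<open>W \<ltimes> q Q\<close>, because the affine Weyl group is simply transitive on
  alcoves. Hence \<open>\<Sum>w. L (q - asc w) = [Z : q Q] = f q\<^sup>l\<close> with \<open>l\<close> the rank.
\<close>

section \<open>Quasi-polynomials\<close>

text \<open>The values y i of the l + 1 affine functionals that bound the dilated alcove are
  coordinates on it: its points in Z are exactly the solutions of \<Sum>i. c i * y i = q in natural
  numbers. This explains the weights in asc: requiring y i \<ge> 1 at every ascent of w and
  subtracting these ones lowers the total q by exactly asc w. It also makes L a quasi-polynomial,
  which has to be known before the definite description of L can be used; the counts of solutions
  are built up one weight at a time as antidifferences.

  Alcoves are handled through affine roots. Because \<theta> is the highest root, every affine root
  is a combination of the l + 1 simple ones with coefficients of one sign, and the usual arguments
  with height, exchange and separating hyperplanes apply to the infinite group as they do to W. The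
  perturbation is along \<rho> because \<rho> lies on no root hyperplane and pairs positively with
  exactly the positive roots.

  The case q = 1 of the bijection identifies f itself and shows that it is finite and
  positive.\<close>

lemma monom_antidifference:
  fixes h :: real
  assumes "h \<noteq> 0"
  shows "\<exists>P. \<forall>x. poly P x - poly P (x - h) = x ^ d"
proof (induction d rule: less_induct)
  case (less d)
  then obtain P where P: "\<And>k x. k < d \<Longrightarrow> poly (P k) x - poly (P k) (x - h) = x ^ k"
    by metis
  define b where "b k = real (Suc d choose k) * (- h) ^ (Suc d - k)" for k
  \<comment> \<open>The difference of x ^ Suc d is Suc d * h * x ^ d up to the lower powers of x in
    (x - h) ^ Suc d, whose coefficients are b k; the antidifferences P k of these powers cancel
    them.\<close>
  define Q where "Q = smult (1 / (real (Suc d) * h)) (monom 1 (Suc d) + (\<Sum>k<d. smult (b k) (P k)))"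
  have "poly Q x - poly Q (x - h) = x ^ d" for x
  proof -
    have "(x - h) ^ Suc d = (\<Sum>k\<le>Suc d. b k * x ^ k)"
      using binomial_ring[of x "- h" "Suc d"] by (simp add: b_def mult_ac)
    also have "\<dots> = (\<Sum>k<d. b k * x ^ k) - real (Suc d) * h * x ^ d + x ^ Suc d"
      by (simp add: lessThan_Suc_atMost [symmetric] b_def del: binomial_Suc_Suc)
    finally have 1: "x ^ Suc d - (x - h) ^ Suc d = real (Suc d) * h * x ^ d - (\<Sum>k<d. b k * x ^ k)"
      by simp
    have 2: "(\<Sum>k<d. b k * poly (P k) x) - (\<Sum>k<d. b k * poly (P k) (x - h)) = (\<Sum>k<d. b k * x ^ k)"
      using P by (simp add: sum_subtractf [symmetric] right_diff_distrib [symmetric])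
    have "poly Q x - poly Q (x - h) = 1 / (real (Suc d) * h) * ((x ^ Suc d - (x - h) ^ Suc d) +
       ((\<Sum>k<d. b k * poly (P k) x) - (\<Sum>k<d. b k * poly (P k) (x - h))))"
      unfolding Q_def by (simp only: poly_smult poly_add poly_monom poly_sum) (simp add: algebra_simps)
    also have "\<dots> = x ^ d"
      unfolding 1 2 using assms by simp
    finally show ?thesis .
  qed
  then show ?case by blast
qed

lemma poly_antidifference:
  fixes h :: real
  assumes "h \<noteq> 0"
  shows "\<exists>P. \<forall>x. poly P x - poly P (x - h) = poly p x"
proof -
  obtain P where P: "\<And>d x. poly (P d) x - poly (P d) (x - h) = x ^ d"
    using monom_antidifference[OF assms] by metis
  have "poly (\<Sum>i\<le>degree p. smult (coeff p i) (P i)) x - poly (\<Sum>i\<le>degree p. smult (coeff p i) (P i)) (x - h)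
      = poly p x" for x
    using P by (simp add: poly_sum sum_subtractf [symmetric] right_diff_distrib [symmetric] poly_altdef[of p])
  then show ?thesis by blast
qed

text \<open>The period hidden in \<open>quasi_polynomial\<close> is made explicit, so that two
  quasi-polynomials can be brought to a common multiple.\<close>

definition quasi_polynomial_period :: "nat \<Rightarrow> (int \<Rightarrow> real) \<Rightarrow> bool" where
  "quasi_polynomial_period N g \<longleftrightarrow>
     N > 0 \<and> (\<exists>p::int \<Rightarrow> real poly. \<forall>t. g t = poly (p (t mod int N)) (of_int t))"

lemma quasi_polynomial_iff_period: "quasi_polynomial g \<longleftrightarrow> (\<exists>N. quasi_polynomial_period N g)"
  unfolding quasi_polynomial_def quasi_polynomial_period_def by blast

lemma quasi_polynomial_period_mult:
  assumes "quasi_polynomial_period N g" and "M > 0"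
  shows "quasi_polynomial_period (N * M) g"
proof -
  obtain p :: "int \<Rightarrow> real poly" where p: "\<And>t. g t = poly (p (t mod int N)) (of_int t)" and "N > 0"
    using assms(1) unfolding quasi_polynomial_period_def by blast
  have "g t = poly (p (t mod int (N * M) mod int N)) (of_int t)" for t
    by (subst mod_mod_cancel) (simp_all add: p)
  with \<open>N > 0\<close> assms(2) show ?thesis
    unfolding quasi_polynomial_period_def by (intro conjI exI[of _ "\<lambda>r. p (r mod int N)"]) auto
qed

lemma quasi_polynomial_common_period:
  assumes "quasi_polynomial f" and "quasi_polynomial g"
  obtains N where "quasi_polynomial_period N f" and "quasi_polynomial_period N g"
proof -
  obtain M N where "quasi_polynomial_period M f" "quasi_polynomial_period N g"
    using assms unfolding quasi_polynomial_iff_period by blast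
  then have "quasi_polynomial_period (M * N) f" "quasi_polynomial_period (N * M) g"
    by (meson quasi_polynomial_period_mult quasi_polynomial_period_def)+
  with that show ?thesis by (simp add: mult.commute)
qed

section \<open>Operations on quasi-polynomials, and their determination by large arguments\<close>

lemma quasi_polynomial_add:
  assumes "quasi_polynomial f" and "quasi_polynomial g"
  shows "quasi_polynomial (\<lambda>t. f t + g t)"
proof -
  obtain N where "quasi_polynomial_period N f" "quasi_polynomial_period N g"
    using quasi_polynomial_common_period[OF assms] .
  then obtain p r :: "int \<Rightarrow> real poly" where "N > 0"
    and "\<And>t. f t = poly (p (t mod int N)) (of_int t)" "\<And>t. g t = poly (r (t mod int N)) (of_int t)"
    unfolding quasi_polynomial_period_def by blast
  then show ?thesis unfolding quasi_polynomial_def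
    by (intro exI[of _ N] conjI exI[of _ "\<lambda>k. p k + r k"]) auto
qed

lemma quasi_polynomial_cmult:
  assumes "quasi_polynomial f"
  shows "quasi_polynomial (\<lambda>t. a * f t)"
proof -
  obtain N p where "N > 0" "\<And>t. f t = poly (p (t mod int N)) (of_int t)"
    using assms unfolding quasi_polynomial_def by blast
  then show ?thesis unfolding quasi_polynomial_def
    by (intro exI[of _ N] conjI exI[of _ "\<lambda>k. smult a (p k)"]) auto
qed

lemma quasi_polynomial_poly: "quasi_polynomial (\<lambda>t. poly p (of_int t))"
  unfolding quasi_polynomial_def by (intro exI[of _ 1] conjI exI[of _ "\<lambda>_. p"]) auto

lemma quasi_polynomial_periodic:
  assumes "N > 0"
  shows "quasi_polynomial (\<lambda>t. f (t mod int N))"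
  unfolding quasi_polynomial_def using assms
  by (intro exI[of _ N] conjI exI[of _ "\<lambda>k. [:f k:]"]) auto

lemma quasi_polynomial_sum:
  assumes "\<And>i. i \<in> A \<Longrightarrow> quasi_polynomial (f i)"
  shows "quasi_polynomial (\<lambda>t. \<Sum>i\<in>A. f i t)"
  using assms
proof (induction A rule: infinite_finite_induct)
  case (insert x A)
  then show ?case by (auto intro: quasi_polynomial_add)
qed (use quasi_polynomial_poly[of 0] in simp_all)

lemma quasi_polynomial_shift:
  assumes "quasi_polynomial f"
  shows "quasi_polynomial (\<lambda>t. f (t - k))"
proof -
  obtain N p where "N > 0" "\<And>t. f t = poly (p (t mod int N)) (of_int t)"
    using assms unfolding quasi_polynomial_def by blast
  then show ?thesis unfolding quasi_polynomial_def
    by (intro exI[of _ N] conjI exI[of _ "\<lambda>r. pcompose (p ((r - k) mod int N)) [:- of_int k, 1:]"])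
       (auto simp: poly_pcompose mod_diff_left_eq)
qed

text \<open>On one residue class both sides are polynomials, and their difference has infinitely
  many roots beyond B. This is the passage from counts at large arguments to all integers, negative
  ones included.\<close>

lemma quasi_polynomial_eqI:
  assumes "quasi_polynomial f" and "quasi_polynomial g" and eq: "\<And>t. t \<ge> B \<Longrightarrow> f t = g t"
  shows "f = g"
proof
  fix s :: int
  obtain N where "quasi_polynomial_period N f" "quasi_polynomial_period N g"
    using quasi_polynomial_common_period[OF assms(1,2)] .
  then obtain p r :: "int \<Rightarrow> real poly" where N: "N > 0"
    and f: "\<And>t. f t = poly (p (t mod int N)) (of_int t)"
    and g: "\<And>t. g t = poly (r (t mod int N)) (of_int t)"
    unfolding quasi_polynomial_period_def by blast
  define D where "D = p (s mod int N) - r (s mod int N)"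
  \<comment> \<open>Arguments in the residue class of s; since N \<ge> 1, the offset by the distance
    from s to B puts all of them beyond B.\<close>
  define X where "X = (\<lambda>k::nat. real_of_int (s + int N * int (nat \<bar>B - s\<bar> + k))) ` UNIV"
  have "poly D x = 0" if "x \<in> X" for x
  proof -
    obtain k where k: "x = real_of_int (s + int N * int (nat \<bar>B - s\<bar> + k))"
      using \<open>x \<in> X\<close> unfolding X_def by blast
    let ?t = "s + int N * int (nat \<bar>B - s\<bar> + k)"
    have "B \<le> s + 1 * int (nat \<bar>B - s\<bar> + k)"
      by simp
    also have "\<dots> \<le> ?t"
      using N by (intro add_left_mono mult_right_mono) auto
    finally have "?t \<ge> B" .
    then have "f ?t = g ?t" by (rule eq)
    then show ?thesis by (simp add: f g k D_def)
  qed
  moreover have "infinite X"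
    unfolding X_def using N by (intro range_inj_infinite injI) auto
  ultimately have "D = 0"
    using poly_roots_finite[of D] finite_subset[of X "{x. poly D x = 0}"] by blast
  then show "f s = g s" by (simp add: f g D_def)
qed

text \<open>A step of length N * c stays in one residue class modulo N, so polynomial
  antidifferences, class by class, give H for this longer step.\<close>

lemma quasi_polynomial_antidifference:
  assumes "quasi_polynomial g" and "c > 0"
  shows "\<exists>G. quasi_polynomial G \<and> (\<forall>t. G t - G (t - int c) = g t)"
proof -
  obtain N p where N: "N > 0" and p: "\<And>t. g t = poly (p (t mod int N)) (of_int t)"
    using assms unfolding quasi_polynomial_def by blast
  obtain P where P: "\<And>r x. poly (P r) x - poly (P r) (x - real (N * c)) = poly (p r) x"
  proof -
    have "real (N * c) \<noteq> 0" using N assms(2) by simp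
    then have "\<forall>r. \<exists>P. \<forall>x. poly P x - poly P (x - real (N * c)) = poly (p r) x"
      using poly_antidifference by blast
    then show ?thesis using that by metis
  qed
  define H where "H t = poly (P (t mod int (N * c) mod int N)) (of_int t)" for t
  have H: "H t - H (t - int (N * c)) = g t" for t
  proof -
    have "(t - int (N * c)) mod int (N * c) = t mod int (N * c)"
      by simp
    moreover have "t mod int (N * c) mod int N = t mod int N"
      by (rule mod_mod_cancel) simp
    ultimately show ?thesis
      unfolding H_def using P[of "t mod int N" "of_int t"] by (simp add: p)
  qed
  have qH: "quasi_polynomial H"
    unfolding quasi_polynomial_def H_def using N assms(2)
    by (intro exI[of _ "N * c"] conjI exI[of _ "\<lambda>r. P (r mod int N)"]) auto
  \<comment> \<open>Adding N shifts of H by multiples of c makes the differences with step c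
    telescope to the difference of H with step N * c.\<close>
  define G where "G t = (\<Sum>j<N. H (t - int (j * c)))" for t
  have "quasi_polynomial G"
    unfolding G_def by (intro quasi_polynomial_sum quasi_polynomial_shift qH)
  moreover have "G t - G (t - int c) = g t" for t
  proof -
    have "G t - G (t - int c) = (\<Sum>j<N. H (t - int (j * c)) - H (t - int (Suc j * c)))"
      unfolding G_def by (simp add: sum_subtractf algebra_simps)
    also have "\<dots> = H t - H (t - int (N * c))"
      using sum_lessThan_telescope'[of "\<lambda>j. H (t - int (j * c))" N] by simp
    finally show ?thesis using H by simp
  qed
  ultimately show ?thesis by blast
qed

section \<open>Restricted partition functions\<close>

text \<open>Values beyond k are fixed to 0, which makes the set finite for positive weights and
  makes the set for k literally the part of the set for Suc k where y (Suc k) = 0.\<close>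

definition partitions_with_weights :: "(nat \<Rightarrow> nat) \<Rightarrow> nat \<Rightarrow> nat \<Rightarrow> (nat \<Rightarrow> nat) set" where
  "partitions_with_weights c k q = {y. (\<forall>i>k. y i = 0) \<and> (\<Sum>i\<le>k. c i * y i) = q}"

lemma finite_partitions_with_weights:
  assumes "\<And>i. i \<le> k \<Longrightarrow> c i > 0"
  shows "finite (partitions_with_weights c k q)"
proof (rule finite_subset)
  show "partitions_with_weights c k q \<subseteq> {y. \<forall>i. (i \<in> {..k} \<longrightarrow> y i \<in> {..q}) \<and> (i \<notin> {..k} \<longrightarrow> y i = 0)}"
  proof (clarsimp simp: partitions_with_weights_def)
    fix y i assume "i \<le> k"
    then have "y i \<le> c i * y i" using assms[of i] by simp
    also have "\<dots> \<le> (\<Sum>i\<le>k. c i * y i)"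
      using \<open>i \<le> k\<close> by (intro member_le_sum) auto
    finally show "y i \<le> (\<Sum>i\<le>k. c i * y i)" .
  qed
  show "finite {y. \<forall>i. (i \<in> {..k} \<longrightarrow> y i \<in> {..q}) \<and> (i \<notin> {..k} \<longrightarrow> y i = (0::nat))}"
    by (intro finite_set_of_finite_funs) auto
qed

text \<open>The solutions are split by whether the last part occurs; if it does, one copy of it is
  removed.\<close>

lemma card_partitions_with_weights_Suc:
  assumes "\<And>i. i \<le> Suc k \<Longrightarrow> c i > 0" and "c (Suc k) \<le> q"
  shows "card (partitions_with_weights c (Suc k) q) =
    card (partitions_with_weights c (Suc k) (q - c (Suc k))) + card (partitions_with_weights c k q)"
proof -
  let ?T = "partitions_with_weights c" and ?S = "\<lambda>y::nat \<Rightarrow> nat. y(Suc k := Suc (y (Suc k)))"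
  have "?T (Suc k) q = ?S ` ?T (Suc k) (q - c (Suc k)) \<union> ?T k q" (is "?l = ?r")
  proof (intro equalityI subsetI)
    fix y assume y: "y \<in> ?l"
    show "y \<in> ?r"
    proof (cases "y (Suc k)")
      case 0
      with y show ?thesis by (auto simp: partitions_with_weights_def) (metis Suc_lessI 0)
    next
      case (Suc m)
      with y have "y(Suc k := m) \<in> ?T (Suc k) (q - c (Suc k))"
        by (auto simp: partitions_with_weights_def)
      moreover have "y = ?S (y(Suc k := m))" using Suc by auto
      ultimately show ?thesis by blast
    qed
  next
    fix y assume "y \<in> ?r"
    then show "y \<in> ?l"
      using assms(2) by (auto simp: partitions_with_weights_def)
  qed
  moreover have "?S ` ?T (Suc k) (q - c (Suc k)) \<inter> ?T k q = {}"
    by (auto simp: partitions_with_weights_def)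
  moreover have "inj ?S"
    by (intro injI ext) (metis fun_upd_apply nat.inject)
  moreover have "finite (?T (Suc k) (q - c (Suc k)))" "finite (?T k q)"
    using assms(1) by (auto intro!: finite_partitions_with_weights)
  ultimately show ?thesis
    by (simp add: card_Un_disjoint card_image inj_on_subset)
qed

text \<open>By the recurrence, the count for Suc k and an antidifference G of the count for k have
  the same differences with step c (Suc k). Their difference D is therefore periodic, and periodic
  functions are quasi-polynomials.\<close>

lemma quasi_polynomial_card_partitions_with_weights:
  assumes "c 0 = 1" and "\<And>i. i \<le> k \<Longrightarrow> c i > 0"
  shows "\<exists>L. quasi_polynomial L \<and> (\<forall>q. L (int q) = real (card (partitions_with_weights c k q)))"
  using assms(2)
proof (induction k)
  case 0
  \<comment> \<open>With the single weight c 0 = 1 the only solution is y 0 = q, so the count is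
    constantly 1.\<close>
  have "partitions_with_weights c 0 q = {(\<lambda>_. 0)(0 := q)}" for q
    using assms(1) by (auto simp: partitions_with_weights_def)
  then show ?case using quasi_polynomial_poly[of 1] by (intro exI[of _ "\<lambda>_. 1"]) simp
next
  case (Suc k)
  let ?p = "\<lambda>k q. real (card (partitions_with_weights c k q))"
  let ?c = "c (Suc k)"
  have c: "?c > 0" using Suc.prems by simp
  obtain L where L: "quasi_polynomial L" "\<And>q. L (int q) = ?p k q"
    using Suc.IH Suc.prems by (meson le_SucI)
  obtain G where G: "quasi_polynomial G" "\<And>t. G t - G (t - int ?c) = L t"
    using quasi_polynomial_antidifference[OF L(1) c] by blast
  define D where "D q = ?p (Suc k) q - G (int q)" for q
  have D: "D q = D (q mod ?c)" for q
  proof (induction q rule: less_induct)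
    case (less q)
    show ?case
    proof (cases "q < ?c")
      case False
      then have q: "q \<ge> ?c" by simp
      have "D q = D (q - ?c)"
        using card_partitions_with_weights_Suc[of k c q, OF Suc.prems q] G(2)[of "int q"] L(2)[of q] q
        by (simp add: D_def of_nat_diff)
      also have "\<dots> = D ((q - ?c) mod ?c)"
        using q c by (intro less) auto
      finally show ?thesis using q by (simp add: le_mod_geq)
    qed simp
  qed
  have "quasi_polynomial (\<lambda>t. G t + D (nat (t mod int ?c)))"
    by (intro quasi_polynomial_add G(1) quasi_polynomial_periodic[where f = "\<lambda>r. D (nat r)"] c)
  moreover have "G (int q) + D (nat (int q mod int ?c)) = ?p (Suc k) q" for q
  proof -
    have "nat (int q mod int ?c) = q mod ?c" by (simp flip: of_nat_mod)
    then show ?thesis using D[of q] by (simp add: D_def)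
  qed
  ultimately show ?case by blast
qed

section \<open>Affine functionals and affine reflections\<close>

text \<open>A pair (\<beta>, m) encodes the affine functional x \<mapsto> \<beta> \<bullet> x + m.
  Then \<open>arefl\<close> is the reflection in its zero hyperplane, and \<open>aact b a\<close> is
  the functional a composed with the reflection of b.\<close>

definition aeval :: "'a::euclidean_space \<times> real \<Rightarrow> 'a \<Rightarrow> real" where
  "aeval a x = fst a \<bullet> x + snd a"

definition arefl :: "'a::euclidean_space \<times> real \<Rightarrow> 'a \<Rightarrow> 'a" where
  "arefl a x = x - (2 * aeval a x / (fst a \<bullet> fst a)) *\<^sub>R fst a"

definition aact :: "'a::euclidean_space \<times> real \<Rightarrow> 'a \<times> real \<Rightarrow> 'a \<times> real" where
  "aact b a = a - (2 * (fst b \<bullet> fst a) / (fst b \<bullet> fst b)) *\<^sub>R b"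

lemma aeval_diff: "aeval (a - b) x = aeval a x - aeval b x"
  by (simp add: aeval_def algebra_simps)

lemma aeval_minus [simp]: "aeval (- a) x = - aeval a x"
  by (simp add: aeval_def)

lemma aeval_scaleR: "aeval (r *\<^sub>R a) x = r * aeval a x"
  by (simp add: aeval_def algebra_simps)

lemma aeval_sum: "aeval (\<Sum>i\<in>I. f i) x = (\<Sum>i\<in>I. aeval (f i) x)"
  by (simp add: aeval_def fst_sum snd_sum inner_sum_left sum.distrib)

lemma arefl_minus: "arefl (- a) = arefl a"
  by (simp add: arefl_def fun_eq_iff)

lemma aeval_arefl: "aeval a (arefl b x) = aeval (aact b a) x"
  by (simp add: aact_def aeval_diff aeval_scaleR)
     (simp add: aeval_def arefl_def algebra_simps inner_commute)

lemma aeval_arefl_self: "fst b \<noteq> 0 \<Longrightarrow> aeval b (arefl b x) = - aeval b x"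
  by (simp add: aeval_arefl aact_def aeval_diff aeval_scaleR)

lemma arefl_arefl: "fst b \<noteq> 0 \<Longrightarrow> arefl b (arefl b x) = x"
  by (subst arefl_def) (simp add: aeval_arefl_self, simp add: arefl_def)

lemma aact_aact: "fst b \<noteq> 0 \<Longrightarrow> aact b (aact b a) = a"
  by (simp add: aact_def inner_diff_right)

lemma inner_aact:
  assumes "fst b \<noteq> 0"
  shows "fst (aact b a) \<bullet> fst (aact b a) = fst a \<bullet> fst a"
  using assms by (simp add: aact_def inner_diff_left inner_diff_right inner_commute)

text \<open>The rule s_a s_b = s_b s_a', where a' is the image of a under s_b. With b simple it
  trades a for a lower root, or moves a reflection past the first letter of a word.\<close>

lemma arefl_conj:
  assumes "fst b \<noteq> 0"
  shows "arefl a (arefl b x) = arefl b (arefl (aact b a) x)"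
proof -
  define N where "N = 2 * (fst b \<bullet> fst a) / (fst b \<bullet> fst b)"
  define k where "k = 2 * aeval (aact b a) x / (fst a \<bullet> fst a)"
  have N: "N * (fst b \<bullet> fst b) = 2 * (fst b \<bullet> fst a)"
    using assms by (simp add: N_def)
  have fa: "fst (aact b a) = fst a - N *\<^sub>R fst b"
    by (simp add: aact_def N_def)
  have r: "arefl (aact b a) x = x - k *\<^sub>R (fst a - N *\<^sub>R fst b)"
    unfolding arefl_def inner_aact[OF assms] k_def by (simp add: fa)
  have e: "aeval b (arefl (aact b a) x) = aeval b x + k * (fst b \<bullet> fst a)"
    unfolding r aeval_def using N by (simp add: algebra_simps)
  have "2 * aeval b (arefl (aact b a) x) / (fst b \<bullet> fst b) = 2 * aeval b x / (fst b \<bullet> fst b) + k * N"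
    unfolding e N_def by (simp add: add_divide_distrib algebra_simps)
  then have "arefl b (arefl (aact b a) x) =
      (x - k *\<^sub>R (fst a - N *\<^sub>R fst b)) - (2 * aeval b x / (fst b \<bullet> fst b) + k * N) *\<^sub>R fst b"
    by (subst arefl_def) (simp add: r)
  moreover have "arefl a (arefl b x) = (x - (2 * aeval b x / (fst b \<bullet> fst b)) *\<^sub>R fst b) - k *\<^sub>R fst a"
    by (subst arefl_def) (simp only: aeval_arefl k_def [symmetric], simp only: arefl_def)
  moreover have "(x - k *\<^sub>R (fst a - N *\<^sub>R fst b)) - (2 * aeval b x / (fst b \<bullet> fst b) + k * N) *\<^sub>R fst b =
      (x - (2 * aeval b x / (fst b \<bullet> fst b)) *\<^sub>R fst b) - k *\<^sub>R fst a"
    by (simp add: algebra_simps)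
  ultimately show ?thesis by simp
qed

lemma sum_scaleR_delta:
  fixes f :: "'b \<Rightarrow> 'c::real_vector"
  assumes "finite A" and "j \<in> A"
  shows "(\<Sum>i\<in>A. (if i = j then r else 0) *\<^sub>R f i) = r *\<^sub>R f j"
proof -
  have "(\<Sum>i\<in>A. (if i = j then r else 0) *\<^sub>R f i) = (\<Sum>i\<in>A. if i = j then r *\<^sub>R f i else 0)"
    by (intro sum.cong) auto
  with assms show ?thesis by simp
qed

section \<open>Root systems with a base and a highest root\<close>

text \<open>With \<alpha> 0 = - \<theta> and c 0 = 1 the relation \<Sum>i\<le>l. c i \<alpha> i = 0
  holds among the gradients of the l + 1 walls of the alcove.\<close>

locale based_root_system =
  fixes \<Phi> :: "'a::euclidean_space set" and \<alpha> :: "nat \<Rightarrow> 'a" and c :: "nat \<Rightarrow> nat" and \<theta> :: 'a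
  assumes root_system: "crystallographic_root_system \<Phi>"
    and simple: "simple_roots \<Phi> \<alpha>"
    and highest: "highest_root \<Phi> \<alpha> \<theta>"
    and highest_eq: "\<theta> = (\<Sum>i=1..DIM('a). real (c i) *\<^sub>R \<alpha> i)"
    and alpha_0: "\<alpha> 0 = - \<theta>" and c_0: "c 0 = 1"
begin

section \<open>Elementary facts on roots, and the basis dual to the simple roots\<close>

lemma finite_roots: "finite \<Phi>" and zero_not_root: "0 \<notin> \<Phi>"
  and root_multiple: "\<beta> \<in> \<Phi> \<Longrightarrow> k *\<^sub>R \<beta> \<in> \<Phi> \<Longrightarrow> k = 1 \<or> k = -1"
  and reflection_root: "\<beta> \<in> \<Phi> \<Longrightarrow> \<gamma> \<in> \<Phi> \<Longrightarrow> reflection \<beta> \<gamma> \<in> \<Phi>"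
  and cartan_integer: "\<beta> \<in> \<Phi> \<Longrightarrow> \<gamma> \<in> \<Phi> \<Longrightarrow> 2 * (\<beta> \<bullet> \<gamma>) / (\<beta> \<bullet> \<beta>) \<in> \<int>"
  using root_system unfolding crystallographic_root_system_def by blast+

lemma root_nonzero: "\<beta> \<in> \<Phi> \<Longrightarrow> \<beta> \<noteq> 0"
  using zero_not_root by blast

lemma uminus_root: "\<beta> \<in> \<Phi> \<Longrightarrow> - \<beta> \<in> \<Phi>"
  using reflection_root[of \<beta> \<beta>] root_nonzero[of \<beta>] by (simp add: reflection_def scaleR_2)

lemma simple_root: "i \<le> DIM('a) \<Longrightarrow> \<alpha> i \<in> \<Phi>"
  using simple highest uminus_root[of \<theta>] alpha_0 unfolding simple_roots_def highest_root_def
  by (cases "i = 0") auto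

lemma root_nonneg_comb: "\<beta> \<in> \<Phi> \<Longrightarrow> nonneg_comb \<alpha> \<beta> \<or> nonneg_comb \<alpha> (- \<beta>)"
  using simple unfolding simple_roots_def by blast

lemma span_simple: "span (\<alpha> ` {1..DIM('a)}) = UNIV"
proof -
  have "card (\<alpha> ` {1..DIM('a)}) = DIM('a)" "independent (\<alpha> ` {1..DIM('a)})"
    using simple unfolding simple_roots_def by (simp_all add: card_image)
  then show ?thesis
    using card_eq_dim[of "\<alpha> ` {1..DIM('a)}" UNIV] by auto
qed

text \<open>The functional prescribed on the basis of simple roots is represented by a vector, read
  off from its values on an orthonormal basis.\<close>

lemma simple_dual_exists: "\<exists>x. \<forall>i\<in>{1..DIM('a)}. \<alpha> i \<bullet> x = r i"
proof -
  have inj: "inj_on \<alpha> {1..DIM('a)}" and ind: "independent (\<alpha> ` {1..DIM('a)})"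
    using simple unfolding simple_roots_def by blast+
  obtain g :: "'a \<Rightarrow> real" where g: "linear g"
    and "\<forall>v\<in>\<alpha> ` {1..DIM('a)}. g v = r (the_inv_into {1..DIM('a)} \<alpha> v)"
    using linear_independent_extend[OF ind, of "\<lambda>v. r (the_inv_into {1..DIM('a)} \<alpha> v)"] by blast
  then have "g (\<alpha> i) = r i" if "i \<in> {1..DIM('a)}" for i
    using that inj by (simp add: the_inv_into_f_f)
  moreover have "v \<bullet> (\<Sum>b\<in>Basis. g b *\<^sub>R b) = g v" for v
  proof -
    have "g v = g (\<Sum>b\<in>Basis. (v \<bullet> b) *\<^sub>R b)" by (simp add: euclidean_representation)
    also have "\<dots> = (\<Sum>b\<in>Basis. (v \<bullet> b) * g b)"
      using g by (simp add: linear_sum linear_cmul)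
    finally show ?thesis by (simp add: inner_sum_right mult.commute)
  qed
  ultimately show ?thesis by metis
qed

text \<open>The vector with coordinates r 1, ..., r l in the basis of fundamental coweights; other
  values of r are ignored. Coweights are the vectors with integer coordinates.\<close>

definition simple_dual :: "(nat \<Rightarrow> real) \<Rightarrow> 'a" where
  "simple_dual r = (SOME x. \<forall>i\<in>{1..DIM('a)}. \<alpha> i \<bullet> x = r i)"

lemma inner_simple_dual: "i \<in> {1..DIM('a)} \<Longrightarrow> \<alpha> i \<bullet> simple_dual r = r i"
  unfolding simple_dual_def using someI_ex[OF simple_dual_exists[of r]] by blast

lemma eq_if_inner_simple_eq:
  assumes "\<And>i. i \<in> {1..DIM('a)} \<Longrightarrow> \<alpha> i \<bullet> x = \<alpha> i \<bullet> y"
  shows "x = y"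
proof -
  have "v \<bullet> x = v \<bullet> y" for v
    by (rule linear_eq_on_span[of "\<lambda>v. v \<bullet> x" "\<lambda>v. v \<bullet> y" "\<alpha> ` {1..DIM('a)}"])
       (use assms span_simple in \<open>auto intro: bounded_linear.linear bounded_linear_inner_left\<close>)
  then show ?thesis using vector_eq_ldot by blast
qed

lemma inner_comb_simple_dual:
  "(\<Sum>i=1..DIM('a). r i *\<^sub>R \<alpha> i) \<bullet> simple_dual s = (\<Sum>i=1..DIM('a). r i * s i)"
  by (simp add: inner_sum_left inner_simple_dual)

lemma inner_comb_simple_dual_delta:
  assumes "j \<in> {1..DIM('a)}"
  shows "(\<Sum>i=1..DIM('a). r i *\<^sub>R \<alpha> i) \<bullet> simple_dual (\<lambda>i. if i = j then 1 else 0) = r j"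
  using sum_scaleR_delta[of "{1..DIM('a)}" j 1 r] assms
  unfolding inner_comb_simple_dual by (simp add: mult.commute)

lemma simple_comb_eq_0:
  assumes "(\<Sum>i=1..DIM('a). r i *\<^sub>R \<alpha> i) = 0" and "j \<in> {1..DIM('a)}"
  shows "r j = 0"
  using inner_comb_simple_dual_delta[of j r] assms by simp

text \<open>Since \<theta> - \<alpha> i is a nonnegative combination of simple roots, the
  coefficient of \<alpha> i in \<theta> is at least 1.\<close>

lemma c_pos: "i \<le> DIM('a) \<Longrightarrow> c i > 0"
proof (cases "i = 0")
  case False
  assume "i \<le> DIM('a)"
  with False have i: "i \<in> {1..DIM('a)}" by simp
  have "nonneg_comb \<alpha> (\<theta> - \<alpha> i)"
    using highest simple_root[OF \<open>i \<le> DIM('a)\<close>] unfolding highest_root_def by blast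
  then obtain n :: "nat \<Rightarrow> nat" where "\<theta> - \<alpha> i = (\<Sum>j=1..DIM('a). real (n j) *\<^sub>R \<alpha> j)"
    unfolding nonneg_comb_def by blast
  then have "(\<theta> - \<alpha> i) \<bullet> simple_dual (\<lambda>j. if j = i then 1 else 0) = real (n i)"
    by (simp only: inner_comb_simple_dual_delta[OF i])
  moreover have "\<theta> \<bullet> simple_dual (\<lambda>j. if j = i then 1 else 0) = real (c i)"
    unfolding highest_eq by (simp only: inner_comb_simple_dual_delta[OF i])
  ultimately have "real (c i) = real (n i) + 1"
    using i by (simp add: inner_diff_left inner_simple_dual)
  then show ?thesis by simp
qed (simp add: c_0)

subsection \<open>Affine roots\<close>

definition affine_roots :: "('a \<times> real) set" where
  "affine_roots = \<Phi> \<times> \<int>"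

text \<open>The constant 1 at index 0 turns positivity of this functional into \<theta> \<bullet> x
  < 1, the last wall of the fundamental alcove.\<close>

definition affine_simple :: "nat \<Rightarrow> 'a \<times> real" where
  "affine_simple i = (\<alpha> i, if i = 0 then 1 else 0)"

definition affine_positive :: "'a \<times> real \<Rightarrow> bool" where
  "affine_positive a \<longleftrightarrow> (\<exists>k::nat \<Rightarrow> nat. a = (\<Sum>i\<le>DIM('a). real (k i) *\<^sub>R affine_simple i))"

definition alcove :: "'a set" where
  "alcove = {x. \<forall>i\<le>DIM('a). aeval (affine_simple i) x > 0}"

lemma atMost_DIM: "{..DIM('a)} = insert 0 {1..DIM('a)}"
  by auto

lemma fst_affine_root: "a \<in> affine_roots \<Longrightarrow> fst a \<noteq> 0"
  using root_nonzero unfolding affine_roots_def by auto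

lemma affine_simple_root: "i \<le> DIM('a) \<Longrightarrow> affine_simple i \<in> affine_roots"
  by (auto simp: affine_roots_def affine_simple_def simple_root)

lemma uminus_affine_root: "a \<in> affine_roots \<Longrightarrow> - a \<in> affine_roots"
  by (auto simp: affine_roots_def uminus_root)

lemma aact_affine_root:
  assumes "a \<in> affine_roots" and "b \<in> affine_roots"
  shows "aact b a \<in> affine_roots"
proof -
  have "fst (aact b a) = reflection (fst b) (fst a)"
    by (simp add: aact_def reflection_def)
  moreover have "snd (aact b a) \<in> \<int>"
  proof -
    have "2 * (fst b \<bullet> fst a) / (fst b \<bullet> fst b) \<in> \<int>" "snd a \<in> \<int>" "snd b \<in> \<int>"
      using assms cartan_integer[of "fst b" "fst a"] unfolding affine_roots_def by auto
    then have "snd a - 2 * (fst b \<bullet> fst a) / (fst b \<bullet> fst b) * snd b \<in> \<int>"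
      by (intro Ints_diff Ints_mult)
    then show ?thesis by (simp add: aact_def)
  qed
  ultimately show ?thesis
    using assms reflection_root unfolding affine_roots_def by (auto simp: mem_Times_iff)
qed

text \<open>Only index 0 contributes to the constant term, so independence of the affine simple
  roots reduces to that of the simple roots.\<close>

lemma affine_comb:
  "(\<Sum>i\<le>DIM('a). r i *\<^sub>R affine_simple i) = ((\<Sum>i=1..DIM('a). r i *\<^sub>R \<alpha> i) - r 0 *\<^sub>R \<theta>, r 0)"
proof -
  have "(\<Sum>i\<le>DIM('a). r i *\<^sub>R affine_simple i) =
      r 0 *\<^sub>R affine_simple 0 + (\<Sum>i=1..DIM('a). r i *\<^sub>R affine_simple i)"
    unfolding atMost_DIM by simp
  also have "(\<Sum>i=1..DIM('a). r i *\<^sub>R affine_simple i) = (\<Sum>i=1..DIM('a). (r i *\<^sub>R \<alpha> i, 0))"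
    by (intro sum.cong) (auto simp: affine_simple_def)
  also have "\<dots> = (\<Sum>i=1..DIM('a). r i *\<^sub>R \<alpha> i, 0)"
    by (simp add: prod_eq_iff fst_sum snd_sum)
  finally show ?thesis by (simp add: affine_simple_def alpha_0)
qed

lemma affine_comb_eq_0:
  assumes "(\<Sum>i\<le>DIM('a). r i *\<^sub>R affine_simple i) = 0" and "j \<le> DIM('a)"
  shows "r j = 0"
proof -
  have "r 0 = 0" "(\<Sum>i=1..DIM('a). r i *\<^sub>R \<alpha> i) = 0"
    using assms(1) unfolding affine_comb by (auto simp: prod_eq_iff)
  then show ?thesis using simple_comb_eq_0[of r j] assms(2) by (cases "j = 0") auto
qed

lemma affine_positive_snd: "affine_positive a \<Longrightarrow> snd a \<ge> 0"
  unfolding affine_positive_def by (auto simp: affine_comb)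

text \<open>Up to sign the constant term is positive or zero. If it is zero, this is the dichotomy
  for ordinary roots; if it is positive, the highest root provides the coefficients.\<close>

lemma affine_root_positive_or_negative:
  assumes "a \<in> affine_roots"
  shows "affine_positive a \<or> affine_positive (- a)"
proof -
  have pos: "affine_positive b" if b: "b \<in> affine_roots" "snd b > 0" for b
  proof -
    obtain m where m: "snd b = of_int m"
      using b unfolding affine_roots_def by (auto elim: Ints_cases)
    with b have "m > 0" by simp
    then obtain l where l: "m = int (Suc l)"
      by (metis zero_less_imp_eq_int gr0_implies_Suc)
    have "nonneg_comb \<alpha> (\<theta> - (- fst b))"
      using highest b(1) uminus_root unfolding highest_root_def affine_roots_def by (metis mem_Times_iff)
    then obtain n :: "nat \<Rightarrow> nat" where n: "\<theta> + fst b = (\<Sum>j=1..DIM('a). real (n j) *\<^sub>R \<alpha> j)"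
      unfolding nonneg_comb_def by auto
    \<comment> \<open>For b = (\<beta>, l + 1) these are the coefficients of (l + 1) (- \<theta>, 1)
      + (\<theta> + \<beta>, 0) + l (\<theta>, 0); the middle term is nonnegative because - \<beta>
      is a root below \<theta>.\<close>
    define k where "k i = (if i = 0 then Suc l else n i + l * c i)" for i
    have "(\<Sum>i=1..DIM('a). real (k i) *\<^sub>R \<alpha> i) = (\<Sum>i=1..DIM('a). real (n i) *\<^sub>R \<alpha> i + real l *\<^sub>R real (c i) *\<^sub>R \<alpha> i)"
      by (intro sum.cong) (auto simp: k_def algebra_simps)
    also have "\<dots> = (\<theta> + fst b) + real l *\<^sub>R \<theta>"
      by (simp only: sum.distrib n [symmetric] scaleR_sum_right [symmetric] highest_eq [symmetric])
    finally have "b = (\<Sum>i\<le>DIM('a). real (k i) *\<^sub>R affine_simple i)"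
      unfolding affine_comb prod_eq_iff using m l by (simp add: k_def algebra_simps)
    then show ?thesis unfolding affine_positive_def by blast
  qed
  have zero: "affine_positive b" if b: "nonneg_comb \<alpha> (fst b)" "snd b = 0" for b
  proof -
    obtain n :: "nat \<Rightarrow> nat" where n: "fst b = (\<Sum>j=1..DIM('a). real (n j) *\<^sub>R \<alpha> j)"
      using b unfolding nonneg_comb_def by auto
    have "b = (\<Sum>i\<le>DIM('a). real (if i = 0 then 0 else n i) *\<^sub>R affine_simple i)"
      unfolding affine_comb prod_eq_iff using n b(2) by simp
    then show ?thesis
      unfolding affine_positive_def by (intro exI[of _ "\<lambda>i. if i = 0 then 0 else n i"])
  qed
  consider "snd a > 0" | "snd (- a) > 0" | "snd a = 0" by fastforce
  then show ?thesis
  proof cases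
    case 3
    then show ?thesis
      using zero[of a] zero[of "- a"] root_nonneg_comb[of "fst a"] assms
      unfolding affine_roots_def by auto
  qed (use pos assms uminus_affine_root in blast)+
qed

lemma affine_positive_alcove:
  assumes "a \<in> affine_roots" and "affine_positive a" and "x \<in> alcove"
  shows "aeval a x > 0"
proof -
  obtain k :: "nat \<Rightarrow> nat" where k: "a = (\<Sum>i\<le>DIM('a). real (k i) *\<^sub>R affine_simple i)"
    using assms(2) unfolding affine_positive_def by blast
  have "\<exists>j\<in>{..DIM('a)}. k j \<noteq> 0"
  proof (rule ccontr)
    assume "\<not> ?thesis"
    then have "a = 0" unfolding k by simp
    then show False using fst_affine_root[OF assms(1)] by simp
  qed
  then obtain j where j: "j \<in> {..DIM('a)}" "k j > 0" by auto
  have "aeval a x = (\<Sum>i\<le>DIM('a). real (k i) * aeval (affine_simple i) x)"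
    by (simp add: k aeval_sum aeval_scaleR)
  also have "\<dots> > 0"
  proof (rule sum_pos2[of _ j])
    show "0 \<le> real (k i) * aeval (affine_simple i) x" if "i \<in> {..DIM('a)}" for i
      using assms(3) that by (intro mult_nonneg_nonneg) (auto simp: alcove_def less_imp_le)
  qed (use assms(3) j in \<open>auto simp: alcove_def\<close>)
  finally show ?thesis .
qed

text \<open>No affine root vanishes on the alcove, so a single point of it decides the sign of every
  affine root.\<close>

lemma affine_root_alcove_sign:
  assumes "a \<in> affine_roots" and "x \<in> alcove"
  shows "affine_positive a \<longleftrightarrow> aeval a x > 0" "affine_positive (- a) \<longleftrightarrow> aeval a x < 0" "aeval a x \<noteq> 0"
  using affine_positive_alcove[OF assms(1) _ assms(2)]
    affine_positive_alcove[OF uminus_affine_root[OF assms(1)] _ assms(2)]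
    affine_root_positive_or_negative[OF assms(1)] by auto

lemma alcove_nonempty: "alcove \<noteq> {}"
proof -
  \<comment> \<open>One more than the height of \<theta>, so that dividing
    \<open>simple_dual (\<lambda>_. 1)\<close> by s brings the value of \<theta> down to (s - 1) /
    s.\<close>
  define s where "s = (\<Sum>i=1..DIM('a). real (c i)) + 1"
  have s: "s > 0" unfolding s_def by (intro add_nonneg_pos sum_nonneg) auto
  have "\<theta> \<bullet> simple_dual (\<lambda>_. 1) = s - 1"
    unfolding highest_eq by (simp only: inner_comb_simple_dual) (simp add: s_def)
  then have "\<theta> \<bullet> ((1 / s) *\<^sub>R simple_dual (\<lambda>_. 1)) < 1"
    using s by simp
  moreover have "\<alpha> i \<bullet> ((1 / s) *\<^sub>R simple_dual (\<lambda>_. 1)) > 0" if "i \<in> {1..DIM('a)}" for i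
    using s that by (simp add: inner_simple_dual)
  ultimately have "(1 / s) *\<^sub>R simple_dual (\<lambda>_. 1) \<in> alcove"
    unfolding alcove_def by (auto simp: aeval_def affine_simple_def alpha_0)
  then show ?thesis by blast
qed

text \<open>A simple reflection changes only the coefficient at i. If the image were negative, all
  other coefficients of a would vanish, and a multiple of a simple root in a reduced system is that
  root up to sign.\<close>

lemma aact_affine_positive:
  assumes i: "i \<le> DIM('a)" and a: "a \<in> affine_roots" "affine_positive a" and ne: "a \<noteq> affine_simple i"
  shows "affine_positive (aact (affine_simple i) a)"
proof (rule ccontr)
  let ?b = "aact (affine_simple i) a"
  assume "\<not> affine_positive ?b"
  then have "affine_positive (- ?b)"
    using affine_root_positive_or_negative aact_affine_root a(1) affine_simple_root[OF i] by blast
  then obtain l :: "nat \<Rightarrow> nat" where l: "- ?b = (\<Sum>i\<le>DIM('a). real (l i) *\<^sub>R affine_simple i)"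
    unfolding affine_positive_def by blast
  obtain k :: "nat \<Rightarrow> nat" where k: "a = (\<Sum>i\<le>DIM('a). real (k i) *\<^sub>R affine_simple i)"
    using a(2) unfolding affine_positive_def by blast
  obtain N where N: "?b = a - N *\<^sub>R affine_simple i"
    unfolding aact_def by blast
  have "(\<Sum>j\<le>DIM('a). (real (k j) + real (l j) - (if j = i then N else 0)) *\<^sub>R affine_simple j) =
      a + (- ?b) - N *\<^sub>R affine_simple i"
    unfolding scaleR_diff_left scaleR_add_left sum_subtractf sum.distrib k [symmetric] l [symmetric]
    using sum_scaleR_delta[of "{..DIM('a)}" i N affine_simple] i by simp
  also have "\<dots> = 0" using N by simp
  finally have "(\<Sum>j\<le>DIM('a). (real (k j) + real (l j) - (if j = i then N else 0)) *\<^sub>R affine_simple j) = 0" .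
  note z = affine_comb_eq_0[OF this]
  have "k j = 0" if "j \<le> DIM('a)" "j \<noteq> i" for j
    using z[OF that(1)] that(2) by simp
  then have "a = (\<Sum>j\<le>DIM('a). if j = i then real (k i) *\<^sub>R affine_simple i else 0)"
    unfolding k by (intro sum.cong) auto
  then have ai: "a = real (k i) *\<^sub>R affine_simple i"
    using i by simp
  then have "real (k i) *\<^sub>R \<alpha> i \<in> \<Phi>"
    using a(1) unfolding affine_roots_def affine_simple_def by auto
  then have "real (k i) = 1"
    using root_multiple[OF simple_root[OF i], of "real (k i)"] by auto
  then show False using ai ne by simp
qed

subsection \<open>The affine Weyl group\<close>

text \<open>Elements of the affine Weyl group are carried as words in the simple reflections, whose
  length is available for induction.\<close>

primrec word :: "nat list \<Rightarrow> 'a \<Rightarrow> 'a" where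
  "word [] x = x"
| "word (i # ws) x = arefl (affine_simple i) (word ws x)"

lemma word_append: "word (us @ vs) x = word us (word vs x)"
  by (induction us) auto

lemma arefl_simple_involution: "i \<le> DIM('a) \<Longrightarrow> arefl (affine_simple i) (arefl (affine_simple i) x) = x"
  using arefl_arefl fst_affine_root affine_simple_root by blast

lemma word_rev: "set ws \<subseteq> {..DIM('a)} \<Longrightarrow> word (rev ws) (word ws x) = x"
  by (induction ws arbitrary: x) (auto simp: word_append arefl_simple_involution)

text \<open>Induction on the height of a positive root. Since the gradient of a has positive norm,
  some simple root pairs positively with it; reflecting in that root lowers the height, and
  conjugating back costs two letters.\<close>

lemma arefl_eq_word:
  assumes "a \<in> affine_roots"
  shows "\<exists>ws. set ws \<subseteq> {..DIM('a)} \<and> arefl a = word ws"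
proof -
  have main: "\<exists>ws. set ws \<subseteq> {..DIM('a)} \<and> arefl a = word ws"
    if "a \<in> affine_roots" "a = (\<Sum>i\<le>DIM('a). real (k i) *\<^sub>R affine_simple i)" for a and k :: "nat \<Rightarrow> nat"
    using that
  proof (induction "\<Sum>i\<le>DIM('a). k i" arbitrary: a k rule: less_induct)
    case less
    have "0 < fst a \<bullet> fst a"
      using fst_affine_root[OF less.prems(1)] by simp
    also have "fst a \<bullet> fst a = (\<Sum>i\<le>DIM('a). real (k i) * (\<alpha> i \<bullet> fst a))"
    proof -
      have "fst a = (\<Sum>i\<le>DIM('a). real (k i) *\<^sub>R \<alpha> i)"
        unfolding less.prems(2) by (simp add: fst_sum affine_simple_def)
      then show ?thesis by (metis (no_types, lifting) inner_scaleR_left inner_sum_left sum.cong)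
    qed
    finally have "\<not> (\<forall>i\<in>{..DIM('a)}. real (k i) * (\<alpha> i \<bullet> fst a) \<le> 0)"
      using sum_nonpos[of "{..DIM('a)}" "\<lambda>i. real (k i) * (\<alpha> i \<bullet> fst a)"] by force
    then obtain i where i: "i \<le> DIM('a)" "real (k i) * (\<alpha> i \<bullet> fst a) > 0"
      by force
    then have ki: "k i > 0" "\<alpha> i \<bullet> fst a > 0"
      by (auto simp: zero_less_mult_iff)
    show ?case
    proof (cases "a = affine_simple i")
      case True
      with i(1) show ?thesis by (intro exI[of _ "[i]"]) auto
    next
      case False
      let ?b = "aact (affine_simple i) a"
      have b: "?b \<in> affine_roots"
        using aact_affine_root affine_simple_root[OF i(1)] less.prems(1) by blast
      define N where "N = 2 * (\<alpha> i \<bullet> fst a) / (\<alpha> i \<bullet> \<alpha> i)"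
      have N: "N > 0"
        using ki(2) root_nonzero[OF simple_root[OF i(1)]] by (simp add: N_def)
      have bN: "?b = a - N *\<^sub>R affine_simple i"
        by (simp add: aact_def N_def affine_simple_def)
      have "affine_positive ?b"
        using aact_affine_positive[OF i(1) less.prems(1) _ False] less.prems(2)
        unfolding affine_positive_def by blast
      then obtain l :: "nat \<Rightarrow> nat" where l: "?b = (\<Sum>i\<le>DIM('a). real (l i) *\<^sub>R affine_simple i)"
        unfolding affine_positive_def by blast
      have "(\<Sum>j\<le>DIM('a). (real (k j) - real (l j) - (if j = i then N else 0)) *\<^sub>R affine_simple j) =
          a - ?b - N *\<^sub>R affine_simple i"
        unfolding scaleR_diff_left sum_subtractf less.prems(2) [symmetric] l [symmetric]
        using sum_scaleR_delta[of "{..DIM('a)}" i N affine_simple] i by simp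
      also have "\<dots> = 0" using bN by simp
      finally have "(\<Sum>j\<le>DIM('a). (real (k j) - real (l j) - (if j = i then N else 0)) *\<^sub>R affine_simple j) = 0" .
      note z = affine_comb_eq_0[OF this]
      have lk: "l j \<le> k j" if "j \<le> DIM('a)" for j
        using z[OF that] N by (auto split: if_splits)
      have "l i < k i" using z[OF i(1)] N by simp
      then have "(\<Sum>i\<le>DIM('a). l i) < (\<Sum>i\<le>DIM('a). k i)"
        using lk i(1) by (intro sum_strict_mono_ex1) auto
      from less.hyps[OF this b l] obtain ws where ws: "set ws \<subseteq> {..DIM('a)}" "arefl ?b = word ws"
        by blast
      have "arefl a x = word (i # ws @ [i]) x" for x
      proof -
        have "arefl a x = arefl a (arefl (affine_simple i) (arefl (affine_simple i) x))"
          by (simp add: arefl_simple_involution i(1))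
        also have "\<dots> = arefl (affine_simple i) (arefl ?b (arefl (affine_simple i) x))"
          using arefl_conj fst_affine_root[OF affine_simple_root[OF i(1)]] by blast
        finally show ?thesis by (simp add: ws(2) word_append)
      qed
      then show ?thesis using ws(1) i(1) by (intro exI[of _ "i # ws @ [i]"]) auto
    qed
  qed
  show ?thesis
    using affine_root_positive_or_negative[OF assms] main[OF assms] main[OF uminus_affine_root[OF assms]]
    unfolding affine_positive_def arefl_minus by blast
qed

text \<open>The exchange condition: the hyperplane of a separates x from its image under the word,
  so some letter crosses it, and applying the reflection of a deletes that letter.\<close>

lemma word_exchange:
  assumes "a \<in> affine_roots" and "x \<in> alcove" and "aeval a x > 0"
    and "set ws \<subseteq> {..DIM('a)}" and "aeval a (word ws x) < 0"
  shows "\<exists>vs. set vs \<subseteq> {..DIM('a)} \<and> length vs < length ws \<and> (\<forall>y. arefl a (word ws y) = word vs y)"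
  using assms
proof (induction ws arbitrary: a)
  case (Cons i ws)
  let ?s = "affine_simple i" and ?b = "aact (affine_simple i) a"
  have i: "i \<le> DIM('a)" and s: "?s \<in> affine_roots" "fst ?s \<noteq> 0"
    using Cons.prems affine_simple_root fst_affine_root by auto
  have b: "?b \<in> affine_roots" using aact_affine_root Cons.prems s by blast
  show ?case
  proof (cases "aeval ?b x > 0")
    case True
    have "aeval ?b (word ws x) < 0" using Cons.prems(5) by (simp add: aeval_arefl)
    then obtain vs where vs: "set vs \<subseteq> {..DIM('a)}" "length vs < length ws" "\<And>y. arefl ?b (word ws y) = word vs y"
      using Cons.IH[OF b _ True] Cons.prems by auto
    have "arefl a (word (i # ws) y) = word (i # vs) y" for y
      using arefl_conj[OF s(2), of a "word ws y"] by (simp add: vs(3))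
    with vs(1,2) i show ?thesis by (intro exI[of _ "i # vs"]) auto
  next
    case False
    \<comment> \<open>The simple root itself is the only positive root that its reflection makes
      negative; here the reflection of a cancels the first letter.\<close>
    then have "a = ?s"
      using aact_affine_positive[OF i Cons.prems(1)] affine_root_alcove_sign[OF b Cons.prems(2)]
        affine_root_alcove_sign[OF Cons.prems(1,2)] Cons.prems(3) by blast
    then show ?thesis
      using Cons.prems(4) i by (intro exI[of _ ws]) (auto simp: arefl_simple_involution)
  qed
qed auto

text \<open>The uniqueness half of simple transitivity. The wall of the first letter separates x
  from the image under the remaining word, so exchange yields a word for the same map that is
  shorter by at least two letters.\<close>

lemma word_eq_id:
  assumes "set ws \<subseteq> {..DIM('a)}" and "x \<in> alcove" and "word ws x \<in> alcove"
  shows "word ws y = y"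
  using assms
proof (induction ws rule: length_induct)
  case (1 ws)
  show ?case
  proof (cases ws)
    case (Cons i us)
    let ?s = "affine_simple i"
    have i: "i \<le> DIM('a)" "set us \<subseteq> {..DIM('a)}" using Cons 1 by auto
    have "aeval ?s (word ws x) > 0" using 1 i unfolding alcove_def by simp
    then have "aeval ?s (word us x) < 0"
      using Cons aeval_arefl_self[OF fst_affine_root[OF affine_simple_root[OF i(1)]], of "word us x"] by simp
    moreover have "aeval ?s x > 0" using 1 i unfolding alcove_def by simp
    ultimately obtain vs where vs: "set vs \<subseteq> {..DIM('a)}" "length vs < length us" "\<And>y. word ws y = word vs y"
      using word_exchange[OF affine_simple_root[OF i(1)] 1(3) _ i(2)] Cons by auto
    then show ?thesis using 1 Cons by simp
  qed simp
qed

text \<open>The existence half: as long as y violates a wall inequality, reflecting in that wall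
  lowers the number of affine hyperplanes between y and the alcove.\<close>

lemma word_into_alcove:
  assumes "\<And>a. a \<in> affine_roots \<Longrightarrow> aeval a y \<noteq> 0"
  shows "\<exists>ws. set ws \<subseteq> {..DIM('a)} \<and> word ws y \<in> alcove"
proof -
  \<comment> \<open>The hyperplanes separating y from the alcove. They are finitely many, since a
    positive affine root has constant term at least 0 and a negative value at y bounds this
    term.\<close>
  define M where "M y = {a \<in> affine_roots. affine_positive a \<and> aeval a y < 0}" for y
  have fin: "finite (M y)" for y
  proof (rule finite_subset)
    show "M y \<subseteq> (\<Union>\<beta>\<in>\<Phi>. Pair \<beta> ` of_int ` {0..\<lceil>\<bar>\<beta> \<bullet> y\<bar>\<rceil>})"
    proof
      fix a assume a: "a \<in> M y"
      then obtain \<beta> m where am: "a = (\<beta>, of_int m)" "\<beta> \<in> \<Phi>"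
        unfolding M_def affine_roots_def by (auto elim: Ints_cases)
      with a have "m \<ge> 0" "\<beta> \<bullet> y + of_int m < 0"
        using affine_positive_snd[of a] unfolding M_def aeval_def by auto
      then have "m \<in> {0..\<lceil>\<bar>\<beta> \<bullet> y\<bar>\<rceil>}" by (simp, linarith)
      with am show "a \<in> (\<Union>\<beta>\<in>\<Phi>. Pair \<beta> ` of_int ` {0..\<lceil>\<bar>\<beta> \<bullet> y\<bar>\<rceil>})" by blast
    qed
    show "finite (\<Union>\<beta>\<in>\<Phi>. Pair \<beta> ` real_of_int ` {0..\<lceil>\<bar>\<beta> \<bullet> y\<bar>\<rceil>})"
      using finite_roots by auto
  qed
  show ?thesis
    using assms
  proof (induction "card (M y)" arbitrary: y rule: less_induct)
    case less
    show ?case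
    proof (cases "y \<in> alcove")
      case True
      then show ?thesis by (intro exI[of _ "[]"]) auto
    next
      case False
      then obtain i where i: "i \<le> DIM('a)" "\<not> aeval (affine_simple i) y > 0"
        unfolding alcove_def by blast
      let ?s = "affine_simple i"
      have s: "?s \<in> affine_roots" "fst ?s \<noteq> 0" using affine_simple_root[OF i(1)] fst_affine_root by auto
      have neg: "aeval ?s y < 0" using less.prems[OF s(1)] i(2) by linarith
      have pos: "affine_positive ?s"
        unfolding affine_positive_def
      proof
        show "?s = (\<Sum>j\<le>DIM('a). real (if j = i then 1 else 0) *\<^sub>R affine_simple j)"
          using sum_scaleR_delta[of "{..DIM('a)}" i 1 affine_simple] i(1)
          by (simp add: if_distrib[of real] cong: if_cong)
      qed
      have sM: "?s \<in> M y" using neg pos s unfolding M_def by blast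
      \<comment> \<open>The reflection permutes the other positive affine roots, so it carries the
        separating roots of the new point into those of y, and \<open>?s\<close> is no longer among
        them.\<close>
      have "aact ?s ` M (arefl ?s y) \<subseteq> M y - {?s}"
      proof (rule image_subsetI)
        fix a assume am: "a \<in> M (arefl ?s y)"
        then have a: "a \<in> affine_roots" "affine_positive a" "aeval (aact ?s a) y < 0"
          unfolding M_def by (auto simp: aeval_arefl)
        have "a \<noteq> ?s"
          using am neg aeval_arefl_self[OF s(2), of y] unfolding M_def by auto
        then have p: "affine_positive (aact ?s a)"
          using aact_affine_positive[OF i(1) a(1,2)] by blast
        have "aact ?s a \<noteq> ?s"
        proof
          assume "aact ?s a = ?s"
          then have "a = aact ?s ?s" by (metis aact_aact s(2))
          also have "\<dots> = - ?s" using s(2) by (simp add: aact_def scaleR_2)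
          finally have "affine_positive (- ?s)" using a(2) by simp
          then show False
            using affine_root_alcove_sign[OF s(1)] alcove_nonempty pos by fastforce
        qed
        then show "aact ?s a \<in> M y - {?s}"
          using p a aact_affine_root[OF a(1) s(1)] unfolding M_def by auto
      qed
      moreover have "inj_on (aact ?s) (M (arefl ?s y))"
        using aact_aact[OF s(2)] by (metis inj_onI)
      ultimately have "card (M (arefl ?s y)) \<le> card (M y - {?s})"
        using fin[of y] by (intro card_inj_on_le) auto
      also have "\<dots> < card (M y)"
        using fin[of y] sM by (intro card_Diff1_less)
      finally have "card (M (arefl ?s y)) < card (M y)" .
      moreover have "aeval a (arefl ?s y) \<noteq> 0" if "a \<in> affine_roots" for a
        using less.prems[OF aact_affine_root[OF that s(1)]] by (simp add: aeval_arefl)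
      ultimately obtain ws where "set ws \<subseteq> {..DIM('a)}" "word ws (arefl ?s y) \<in> alcove"
        using less.hyps by blast
      then show ?thesis
        using i(1) by (intro exI[of _ "ws @ [i]"]) (auto simp: word_append)
    qed
  qed
qed

end

context based_root_system
begin

subsection \<open>The Weyl group, coroots and coweights\<close>

lemma reflection_orthogonal: "\<beta> \<in> \<Phi> \<Longrightarrow> orthogonal_transformation (reflection \<beta>)"
proof -
  assume "\<beta> \<in> \<Phi>"
  then have "\<beta> \<bullet> \<beta> \<noteq> 0" using root_nonzero by simp
  then show ?thesis
    unfolding orthogonal_transformation_def reflection_def
    by (auto intro!: linearI simp: algebra_simps add_divide_distrib inner_commute)
qed

lemma weyl_orthogonal: "w \<in> weyl_group \<Phi> \<Longrightarrow> orthogonal_transformation w"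
proof (induction rule: weyl_group.induct)
  case id
  show ?case unfolding id_def by (rule orthogonal_transformation_id)
qed (intro orthogonal_transformation_compose reflection_orthogonal)

lemma weyl_linear: "w \<in> weyl_group \<Phi> \<Longrightarrow> linear w"
  using weyl_orthogonal orthogonal_transformation_linear by blast

lemma inner_weyl: "w \<in> weyl_group \<Phi> \<Longrightarrow> w x \<bullet> w y = x \<bullet> y"
  using weyl_orthogonal unfolding orthogonal_transformation_def by blast

lemma weyl_root: "w \<in> weyl_group \<Phi> \<Longrightarrow> \<beta> \<in> \<Phi> \<Longrightarrow> w \<beta> \<in> \<Phi>"
  by (induction rule: weyl_group.induct) (auto simp: reflection_root)

text \<open>A linear map is determined by the images of the simple roots, and these lie in the
  finite set \<Phi>.\<close>

lemma finite_weyl_group: "finite (weyl_group \<Phi>)"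
proof (rule inj_on_finite)
  show "inj_on (\<lambda>w i. if i \<in> {1..DIM('a)} then w (\<alpha> i) else 0) (weyl_group \<Phi>)"
  proof (rule inj_onI)
    fix w w' assume w: "w \<in> weyl_group \<Phi>" "w' \<in> weyl_group \<Phi>"
      and eq: "(\<lambda>i. if i \<in> {1..DIM('a)} then w (\<alpha> i) else 0) = (\<lambda>i. if i \<in> {1..DIM('a)} then w' (\<alpha> i) else 0)"
    have "w u = w' u" if u: "u \<in> \<alpha> ` {1..DIM('a)}" for u
    proof -
      obtain i where i: "i \<in> {1..DIM('a)}" "u = \<alpha> i" using u by blast
      then show ?thesis using fun_cong[OF eq, of i] by simp
    qed
    moreover have "v \<in> span (\<alpha> ` {1..DIM('a)})" for v
      unfolding span_simple by simp
    ultimately have "w v = w' v" for v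
      using linear_eq_on_span weyl_linear w by blast
    then show "w = w'" by blast
  qed
  show "(\<lambda>w i. if i \<in> {1..DIM('a)} then w (\<alpha> i) else 0) ` weyl_group \<Phi> \<subseteq>
      {f. \<forall>i. (i \<in> {1..DIM('a)} \<longrightarrow> f i \<in> \<Phi>) \<and> (i \<notin> {1..DIM('a)} \<longrightarrow> f i = 0)}"
    using weyl_root simple_root by auto
  show "finite {f. \<forall>i. (i \<in> {1..DIM('a)} \<longrightarrow> f i \<in> \<Phi>) \<and> (i \<notin> {1..DIM('a)} \<longrightarrow> f i = 0)}"
    using finite_roots by (intro finite_set_of_finite_funs) auto
qed

definition coroot :: "'a \<Rightarrow> 'a" where
  "coroot \<beta> = (2 / (\<beta> \<bullet> \<beta>)) *\<^sub>R \<beta>"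

lemma coroot_lattice_iff: "x \<in> coroot_lattice \<Phi> \<longleftrightarrow> (\<exists>n::'a \<Rightarrow> int. x = (\<Sum>\<beta>\<in>\<Phi>. of_int (n \<beta>) *\<^sub>R coroot \<beta>))"
  by (simp add: coroot_lattice_def coroot_def)

lemma coroot_lattice_0: "0 \<in> coroot_lattice \<Phi>"
  unfolding coroot_lattice_iff by (intro exI[of _ "\<lambda>_. 0"]) simp

lemma coroot_lattice_diff:
  assumes "x \<in> coroot_lattice \<Phi>" and "y \<in> coroot_lattice \<Phi>"
  shows "x - y \<in> coroot_lattice \<Phi>"
proof -
  obtain m n :: "'a \<Rightarrow> int" where "x = (\<Sum>\<beta>\<in>\<Phi>. of_int (m \<beta>) *\<^sub>R coroot \<beta>)" "y = (\<Sum>\<beta>\<in>\<Phi>. of_int (n \<beta>) *\<^sub>R coroot \<beta>)"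
    using assms unfolding coroot_lattice_iff by blast
  then show ?thesis
    unfolding coroot_lattice_iff
    by (intro exI[of _ "\<lambda>\<beta>. m \<beta> - n \<beta>"]) (simp add: sum_subtractf algebra_simps)
qed

lemma coroot_multiple: "\<beta> \<in> \<Phi> \<Longrightarrow> of_int m *\<^sub>R coroot \<beta> \<in> coroot_lattice \<Phi>"
  unfolding coroot_lattice_iff
  using sum_scaleR_delta[OF finite_roots, of \<beta> "of_int m" coroot]
  by (intro exI[of _ "\<lambda>\<gamma>. if \<gamma> = \<beta> then m else 0"]) (simp add: if_distrib[of real_of_int] cong: if_cong)

lemma coweight_inner_root:
  assumes "x \<in> coweight_lattice \<alpha>" and "\<beta> \<in> \<Phi>"
  shows "\<beta> \<bullet> x \<in> \<int>"
proof -
  have "\<gamma> \<bullet> x \<in> \<int>" if g: "nonneg_comb \<alpha> \<gamma>" for \<gamma>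
    using g assms(1) unfolding nonneg_comb_def coweight_lattice_def
    by (auto simp: inner_sum_left intro!: Ints_sum Ints_mult)
  from this[of \<beta>] this[of "- \<beta>"] show ?thesis
    using root_nonneg_comb[OF assms(2)] by auto
qed

lemma coroot_lattice_inner_root:
  assumes "x \<in> coroot_lattice \<Phi>" and "\<beta> \<in> \<Phi>"
  shows "\<beta> \<bullet> x \<in> \<int>"
proof -
  obtain n :: "'a \<Rightarrow> int" where n: "x = (\<Sum>\<beta>\<in>\<Phi>. of_int (n \<beta>) *\<^sub>R coroot \<beta>)"
    using assms(1) unfolding coroot_lattice_iff by blast
  have "of_int (n \<gamma>) * (\<beta> \<bullet> coroot \<gamma>) \<in> \<int>" if "\<gamma> \<in> \<Phi>" for \<gamma>
    using cartan_integer[OF that assms(2)]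
    by (intro Ints_mult) (auto simp: coroot_def inner_commute)
  then show ?thesis by (simp add: n inner_sum_right Ints_sum)
qed

lemma coroot_lattice_subset: "coroot_lattice \<Phi> \<subseteq> coweight_lattice \<alpha>"
  using coroot_lattice_inner_root simple_root unfolding coweight_lattice_def by auto

lemma coweight_diff: "x \<in> coweight_lattice \<alpha> \<Longrightarrow> y \<in> coweight_lattice \<alpha> \<Longrightarrow> x - y \<in> coweight_lattice \<alpha>"
  by (simp add: coweight_lattice_def inner_diff_right)

lemma coweight_0: "0 \<in> coweight_lattice \<alpha>"
  by (simp add: coweight_lattice_def)

lemma coweight_scale: "x \<in> coweight_lattice \<alpha> \<Longrightarrow> real q *\<^sub>R x \<in> coweight_lattice \<alpha>"
  by (simp add: coweight_lattice_def Ints_mult)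

lemma simple_dual_coweight: "simple_dual (\<lambda>i. real (t i)) \<in> coweight_lattice \<alpha>"
  by (simp add: coweight_lattice_def inner_simple_dual)

lemma coweight_add: "x \<in> coweight_lattice \<alpha> \<Longrightarrow> y \<in> coweight_lattice \<alpha> \<Longrightarrow> x + y \<in> coweight_lattice \<alpha>"
  by (simp add: coweight_lattice_def inner_add_right)

text \<open>A reflection changes a coweight by an integer multiple of a coroot. For the converse, x
  is tested against \<alpha> i by testing w x against the root w (\<alpha> i).\<close>

lemma weyl_coweight_iff:
  assumes "w \<in> weyl_group \<Phi>"
  shows "w x \<in> coweight_lattice \<alpha> \<longleftrightarrow> x \<in> coweight_lattice \<alpha>"
proof
  assume "w x \<in> coweight_lattice \<alpha>"
  then have "w (\<alpha> i) \<bullet> w x \<in> \<int>" if "i \<in> {1..DIM('a)}" for i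
    using that coweight_inner_root weyl_root[OF assms simple_root] by auto
  then show "x \<in> coweight_lattice \<alpha>"
    by (simp add: inner_weyl[OF assms] coweight_lattice_def)
next
  assume "x \<in> coweight_lattice \<alpha>"
  with assms show "w x \<in> coweight_lattice \<alpha>"
  proof (induction rule: weyl_group.induct)
    case (refl w \<beta>)
    have "reflection \<beta> (w x) = w x - real_of_int \<lfloor>\<beta> \<bullet> w x\<rfloor> *\<^sub>R coroot \<beta>"
      using coweight_inner_root[OF refl.IH[OF refl.prems] refl.hyps(2)]
      by (auto elim!: Ints_cases simp: reflection_def coroot_def)
    also have "\<dots> \<in> coweight_lattice \<alpha>"
      using coroot_multiple[OF refl.hyps(2)] coroot_lattice_subset refl.IH[OF refl.prems]
      by (intro coweight_diff) auto
    finally show ?case by simp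
  qed auto
qed

lemma word_eq_weyl_translation:
  assumes "set ws \<subseteq> {..DIM('a)}"
  shows "\<exists>w\<in>weyl_group \<Phi>. \<exists>l\<in>coroot_lattice \<Phi>. \<forall>x. word ws x = w x + l"
  using assms
proof (induction ws)
  case Nil
  have "\<forall>x. word [] x = id x + 0" by simp
  then show ?case using weyl_group.id coroot_lattice_0 by blast
next
  case (Cons i ws)
  then obtain w l where w: "w \<in> weyl_group \<Phi>" and l: "l \<in> coroot_lattice \<Phi>" and ws: "\<And>x. word ws x = w x + l"
    by auto
  have i: "\<alpha> i \<in> \<Phi>" using Cons.prems simple_root by simp
  obtain m where m: "\<alpha> i \<bullet> l = of_int m"
    using coroot_lattice_inner_root[OF l i] by (auto elim: Ints_cases)
  \<comment> \<open>The value of the affine simple root i at l; the new letter subtracts this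
    multiple of the coroot from the translation part.\<close>
  define n where "n = m + (if i = 0 then 1 else 0)"
  have "word (i # ws) x = (reflection (\<alpha> i) \<circ> w) x + (l - of_int n *\<^sub>R coroot (\<alpha> i))" for x
    by (simp add: ws arefl_def aeval_def affine_simple_def reflection_def n_def coroot_def
        inner_add_right m algebra_simps add_divide_distrib)
  moreover have "reflection (\<alpha> i) \<circ> w \<in> weyl_group \<Phi>"
    by (rule weyl_group.refl[OF w i])
  moreover have "l - of_int n *\<^sub>R coroot (\<alpha> i) \<in> coroot_lattice \<Phi>"
    by (intro coroot_lattice_diff l coroot_multiple i)
  ultimately show ?case by blast
qed

text \<open>Together with the converse above, words describe exactly the maps with linear part in W
  and translation part in Q.\<close>

lemma weyl_translation_eq_word:
  assumes "w \<in> weyl_group \<Phi>" and "l \<in> coroot_lattice \<Phi>"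
  shows "\<exists>ws. set ws \<subseteq> {..DIM('a)} \<and> (\<forall>x. word ws x = w x + l)"
proof -
  have "\<exists>ws. set ws \<subseteq> {..DIM('a)} \<and> (\<forall>x. word ws x = w x)"
    using assms(1)
  proof (induction rule: weyl_group.induct)
    case id
    show ?case by (intro exI[of _ "[]"]) auto
  next
    case (refl w \<beta>)
    then obtain ws where ws: "set ws \<subseteq> {..DIM('a)}" "\<And>x. word ws x = w x" by blast
    have "(\<beta>, 0) \<in> affine_roots" using refl by (simp add: affine_roots_def)
    then obtain us where us: "set us \<subseteq> {..DIM('a)}" "arefl (\<beta>, 0) = word us"
      using arefl_eq_word by blast
    have "word (us @ ws) x = (reflection \<beta> \<circ> w) x" for x
      by (simp add: word_append us(2) [symmetric] ws) (simp add: arefl_def aeval_def reflection_def)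
    with us ws show ?case by (intro exI[of _ "us @ ws"]) auto
  qed
  then obtain ws where ws: "set ws \<subseteq> {..DIM('a)}" "\<And>x. word ws x = w x" by blast
  obtain n :: "'a \<Rightarrow> int" where n: "l = (\<Sum>\<beta>\<in>\<Phi>. of_int (n \<beta>) *\<^sub>R coroot \<beta>)"
    using assms(2) unfolding coroot_lattice_iff by blast
  have "\<exists>us. set us \<subseteq> {..DIM('a)} \<and> (\<forall>x. word us x = x + (\<Sum>\<beta>\<in>S. of_int (n \<beta>) *\<^sub>R coroot \<beta>))"
    if "S \<subseteq> \<Phi>" for S
    using finite_subset[OF that finite_roots] that
  proof (induction S rule: finite_induct)
    case empty
    show ?case by (intro exI[of _ "[]"]) auto
  next
    case (insert \<beta> S)
    then obtain us where us: "set us \<subseteq> {..DIM('a)}"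
      "\<And>x. word us x = x + (\<Sum>\<beta>\<in>S. of_int (n \<beta>) *\<^sub>R coroot \<beta>)" by auto
    have b: "\<beta> \<in> \<Phi>" "\<beta> \<bullet> \<beta> \<noteq> 0" using insert root_nonzero by auto
    obtain vs where vs: "set vs \<subseteq> {..DIM('a)}" "arefl (\<beta>, 0) = word vs"
      using arefl_eq_word[of "(\<beta>, 0)"] b by (auto simp: affine_roots_def)
    obtain vs' where vs': "set vs' \<subseteq> {..DIM('a)}" "arefl (\<beta>, of_int (- n \<beta>)) = word vs'"
      using arefl_eq_word[of "(\<beta>, of_int (- n \<beta>))"] b by (auto simp: affine_roots_def)
    have "word (vs' @ vs @ us) x = x + (\<Sum>\<beta>\<in>insert \<beta> S. of_int (n \<beta>) *\<^sub>R coroot \<beta>)" for x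
    proof -
      \<comment> \<open>Two reflections in parallel hyperplanes compose to a translation orthogonal
        to them; the constant - n \<beta> makes it n \<beta> times the coroot.\<close>
      have "arefl (\<beta>, of_int (- n \<beta>)) (arefl (\<beta>, 0) y) = y + of_int (n \<beta>) *\<^sub>R coroot \<beta>" for y
        using b(2) by (simp add: arefl_def aeval_def coroot_def inner_diff_right diff_divide_distrib algebra_simps)
      then show ?thesis
        using insert.hyps by (simp add: word_append vs(2) [symmetric] vs'(2) [symmetric] us(2) add_ac)
    qed
    then show ?case using vs vs' us by (intro exI[of _ "vs' @ vs @ us"]) auto
  qed
  from this[OF subset_refl] obtain us where us: "set us \<subseteq> {..DIM('a)}" "\<And>x. word us x = x + l"
    unfolding n by blast
  show ?thesis
    using ws us by (intro exI[of _ "us @ ws"]) (auto simp: word_append)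
qed

lemma regular_point_in_alcove_image:
  assumes "\<And>a. a \<in> affine_roots \<Longrightarrow> aeval a y \<noteq> 0"
  obtains w l x where "w \<in> weyl_group \<Phi>" "l \<in> coroot_lattice \<Phi>" "x \<in> alcove" "y = w x + l"
proof -
  obtain ws where ws: "set ws \<subseteq> {..DIM('a)}" "word ws y \<in> alcove"
    using word_into_alcove[OF assms] by blast
  have "y = word (rev ws) (word ws y)" using word_rev[OF ws(1)] by simp
  moreover obtain w l where "w \<in> weyl_group \<Phi>" "l \<in> coroot_lattice \<Phi>" "\<And>x. word (rev ws) x = w x + l"
    using word_eq_weyl_translation[of "rev ws"] ws(1) by auto
  ultimately show ?thesis using that ws(2) by metis
qed

text \<open>One map followed by the inverse of the other sends a point of the alcove into the alcove
  and is therefore the identity. Evaluating at 0 then compares the translations.\<close>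

lemma alcove_image_unique:
  assumes "w \<in> weyl_group \<Phi>" "l \<in> coroot_lattice \<Phi>" "x \<in> alcove"
    and "w' \<in> weyl_group \<Phi>" "l' \<in> coroot_lattice \<Phi>" "x' \<in> alcove"
    and "w x + l = w' x' + l'"
  shows "w = w' \<and> l = l'"
proof -
  obtain us where us: "set us \<subseteq> {..DIM('a)}" "\<And>x. word us x = w x + l"
    using weyl_translation_eq_word[OF assms(1,2)] by blast
  obtain vs where vs: "set vs \<subseteq> {..DIM('a)}" "\<And>x. word vs x = w' x + l'"
    using weyl_translation_eq_word[OF assms(4,5)] by blast
  have "word us x = word vs x'" using us vs assms(7) by simp
  then have "word (rev vs @ us) x = x'"
    using word_rev[OF vs(1), of x'] by (simp add: word_append)
  then have "word (rev vs @ us) v = v" for v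
    using word_eq_id[of "rev vs @ us" x] us vs assms by auto
  then have "word (rev vs) (word us v) = v" for v by (simp add: word_append)
  then have "word us v = word vs v" for v
    using word_rev[of "rev vs" "word us v"] vs(1) by simp
  then have eq: "w v + l = w' v + l'" for v using us vs by simp
  from eq[of 0] have "l = l'"
    using linear_0[OF weyl_linear[OF assms(1)]] linear_0[OF weyl_linear[OF assms(4)]] by simp
  with eq show ?thesis by auto
qed

end

section \<open>Representatives of lattice quotients\<close>

text \<open>A transversal of Z / L becomes a bijection with the classes. It serves for Z / Q and for
  two different transversals of Z / q Q.\<close>

lemma bij_betw_quotient_representatives:
  fixes Z L :: "'a::ab_group_add set" and F :: "'b \<Rightarrow> 'a"
  assumes "0 \<in> L" and diff: "\<And>x y. x \<in> L \<Longrightarrow> y \<in> L \<Longrightarrow> x - y \<in> L"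
    and F: "\<And>p. p \<in> P \<Longrightarrow> F p \<in> Z"
    and unique: "\<And>z. z \<in> Z \<Longrightarrow> \<exists>!p. p \<in> P \<and> z - F p \<in> L"
  defines "R \<equiv> {(x, y). x \<in> Z \<and> y \<in> Z \<and> x - y \<in> L}"
  shows "bij_betw (\<lambda>p. R `` {F p}) P (Z // R)"
proof -
  have "equiv Z R"
  proof (rule equivI)
    show "R \<subseteq> Z \<times> Z" unfolding R_def by auto
    show "refl_on Z R" using \<open>0 \<in> L\<close> unfolding R_def by (auto intro: refl_onI)
    show "sym R"
      unfolding R_def using diff[OF \<open>0 \<in> L\<close>] by (auto intro!: symI) (metis minus_diff_eq diff_0)
    show "trans R"
    proof (rule transI)
      fix x y z assume "(x, y) \<in> R" "(y, z) \<in> R"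
      moreover from this have "0 - (y - z) \<in> L" "x - y \<in> L" using diff \<open>0 \<in> L\<close> unfolding R_def by blast+
      then have "(x - y) - (0 - (y - z)) \<in> L" using diff by blast
      ultimately show "(x, z) \<in> R" unfolding R_def by (auto simp: algebra_simps)
    qed
  qed
  note class_eq = eq_equiv_class_iff[OF this]
  show ?thesis
  proof (rule bij_betwI')
    fix p p' assume p: "p \<in> P" "p' \<in> P"
    have "F p' - F p' \<in> L" using \<open>0 \<in> L\<close> by simp
    then have "F p' - F p \<in> L \<longleftrightarrow> p = p'" using unique[OF F[OF p(2)]] p by blast
    moreover have "R `` {F p} = R `` {F p'} \<longleftrightarrow> R `` {F p'} = R `` {F p}" by blast
    ultimately show "R `` {F p} = R `` {F p'} \<longleftrightarrow> p = p'"
      using class_eq[of "F p'" "F p"] F p unfolding R_def by auto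
  next
    fix p assume "p \<in> P"
    then show "R `` {F p} \<in> Z // R" using F by (auto intro: quotientI)
  next
    fix X assume "X \<in> Z // R"
    then obtain z where z: "z \<in> Z" "X = R `` {z}" by (auto elim: quotientE)
    then obtain p where "p \<in> P" "z - F p \<in> L" using unique by blast
    with z show "\<exists>p\<in>P. X = R `` {F p}"
      using class_eq[of z "F p"] F unfolding R_def by auto
  qed
qed

section \<open>Marked lattice points of the dilated alcove as representatives of Z / q Q\<close>

context based_root_system
begin

text \<open>For q > 0 this is q times the value of \<open>affine_simple i\<close> at x / q.\<close>

definition wall :: "nat \<Rightarrow> nat \<Rightarrow> 'a \<Rightarrow> real" where
  "wall q i x = \<alpha> i \<bullet> x + (if i = 0 then real q else 0)"

lemma wall_Ints: "x \<in> coweight_lattice \<alpha> \<Longrightarrow> i \<le> DIM('a) \<Longrightarrow> wall q i x \<in> \<int>"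
  unfolding wall_def using coweight_inner_root simple_root by auto

text \<open>The dependence on x cancels because \<Sum>i\<le>l. c i \<alpha> i = 0. This is the
  linear equation behind the partition count.\<close>

lemma sum_c_wall: "(\<Sum>i\<le>DIM('a). real (c i) * wall q i x) = real q"
proof -
  have "(\<Sum>i\<le>DIM('a). real (c i) * wall q i x) =
      real (c 0) * wall q 0 x + (\<Sum>i=1..DIM('a). real (c i) * wall q i x)"
    unfolding atMost_DIM by simp
  also have "(\<Sum>i=1..DIM('a). real (c i) * wall q i x) = \<theta> \<bullet> x"
    by (simp add: highest_eq inner_sum_left wall_def)
  finally show ?thesis by (simp add: wall_def alpha_0 c_0)
qed

text \<open>Encoded as a number because it is also the least value allowed for coordinate i of a
  marked point.\<close>

definition ascent :: "('a \<Rightarrow> 'a) \<Rightarrow> nat \<Rightarrow> nat" where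
  "ascent w i = (if w (\<alpha> i) \<in> positive_roots \<Phi> \<alpha> then 1 else 0)"

lemma asc_eq: "asc \<Phi> \<alpha> c w = (\<Sum>i\<le>DIM('a). c i * ascent w i)"
proof -
  have "asc \<Phi> \<alpha> c w = (\<Sum>i\<in>{i \<in> {..DIM('a)}. w (\<alpha> i) \<in> positive_roots \<Phi> \<alpha>}. c i)"
    unfolding asc_def by (intro sum.cong) auto
  also have "\<dots> = (\<Sum>i\<le>DIM('a). if w (\<alpha> i) \<in> positive_roots \<Phi> \<alpha> then c i else 0)"
    by (rule sum.inter_filter) simp
  finally show ?thesis by (simp add: ascent_def if_distrib cong: if_cong)
qed

text \<open>One inequality covers both conditions on x: wall values are integers, so at an ascent
  \<ge> 1 keeps x off the wall, and elsewhere \<ge> 0 keeps it in the closed alcove.\<close>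

definition marked_points :: "nat \<Rightarrow> (('a \<Rightarrow> 'a) \<times> 'a) set" where
  "marked_points q = (SIGMA w:weyl_group \<Phi>. {x \<in> coweight_lattice \<alpha>. \<forall>i\<le>DIM('a). wall q i x \<ge> real (ascent w i)})"

text \<open>The dual Weyl vector, the sum of the fundamental coweights; its product with a root is
  the height of the root.\<close>

abbreviation \<rho> :: 'a where "\<rho> \<equiv> simple_dual (\<lambda>_. 1)"

lemma inner_rho:
  assumes "\<beta> \<in> \<Phi>"
  shows "\<beta> \<bullet> \<rho> \<noteq> 0" "\<beta> \<in> positive_roots \<Phi> \<alpha> \<longleftrightarrow> \<beta> \<bullet> \<rho> > 0"
proof -
  have pos: "\<gamma> \<bullet> \<rho> > 0" if \<gamma>: "nonneg_comb \<alpha> \<gamma>" "\<gamma> \<noteq> 0" for \<gamma>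
  proof -
    obtain n :: "nat \<Rightarrow> nat" where n: "\<gamma> = (\<Sum>i=1..DIM('a). real (n i) *\<^sub>R \<alpha> i)"
      using \<gamma>(1) unfolding nonneg_comb_def by blast
    have "\<exists>j\<in>{1..DIM('a)}. n j \<noteq> 0"
    proof (rule ccontr)
      assume "\<not> ?thesis"
      then show False using \<gamma>(2) unfolding n by simp
    qed
    then obtain j where "j \<in> {1..DIM('a)}" "n j > 0" by auto
    then have "(\<Sum>i=1..DIM('a). real (n i)) > 0"
      by (intro sum_pos2[of _ j]) auto
    then show ?thesis by (simp add: n inner_comb_simple_dual del: One_nat_def)
  qed
  have "\<beta> \<noteq> 0" using assms root_nonzero by blast
  then show "\<beta> \<bullet> \<rho> \<noteq> 0" "\<beta> \<in> positive_roots \<Phi> \<alpha> \<longleftrightarrow> \<beta> \<bullet> \<rho> > 0"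
    using pos[of \<beta>] pos[of "- \<beta>"] root_nonneg_comb[OF assms] assms
    unfolding positive_roots_def by auto
qed

lemma small_rho_exists: "\<exists>\<epsilon>>0. \<forall>\<beta>\<in>\<Phi>. \<bar>\<epsilon> * (\<beta> \<bullet> \<rho>)\<bar> < 1"
proof -
  define M where "M = (\<Sum>\<beta>\<in>\<Phi>. \<bar>\<beta> \<bullet> \<rho>\<bar>)"
  have M: "\<bar>\<beta> \<bullet> \<rho>\<bar> \<le> M" if "\<beta> \<in> \<Phi>" for \<beta>
    unfolding M_def using that finite_roots by (intro member_le_sum) auto
  have "M \<ge> 0" unfolding M_def by (intro sum_nonneg) auto
  with M show ?thesis
    by (intro exI[of _ "1 / (M + 1)"]) (force simp: abs_mult)
qed

text \<open>A perturbation smaller than 1 only matters at u = 0, where its sign decides; the strict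
  inequality becomes an integral one.\<close>

lemma int_real_between:
  fixes u e :: real
  assumes "u \<in> \<int>" and "\<bar>e\<bar> < 1" and "e \<noteq> 0"
  shows "u - e > 0 \<longleftrightarrow> u \<ge> (if e > 0 then 1 else 0)"
proof -
  obtain m where "u = of_int m" using assms(1) by (auto elim: Ints_cases)
  moreover consider "m \<le> -1" | "m = 0" | "m \<ge> 1" by linarith
  then have "of_int m - e > 0 \<longleftrightarrow> of_int m \<ge> (if e > 0 then 1 else 0 :: real)"
  proof cases
    case 1
    then have "real_of_int m \<le> -1" by linarith
    with assms(2) show ?thesis by auto
  next
    case 2
    with assms(3) show ?thesis by auto
  next
    case 3
    then have "real_of_int m \<ge> 1" by linarith
    with assms(2) show ?thesis by auto
  qed
  ultimately show ?thesis by simp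
qed

text \<open>Moving \<open>z\<close> by a small negative multiple of \<open>\<rho>\<close> puts it into the interior of one alcove; the walls
  through \<open>x\<close> have to be left on the side of the alcove, and the ascents of \<open>w\<close> tell which these are.\<close>

lemma perturbed_in_alcove_iff:
  assumes w: "w \<in> weyl_group \<Phi>" and x: "x \<in> coweight_lattice \<alpha>" and v: "w v = \<rho>" and "q > 0"
    and eps: "\<epsilon> > 0" "\<forall>\<beta>\<in>\<Phi>. \<bar>\<epsilon> * (\<beta> \<bullet> \<rho>)\<bar> < 1"
  shows "(1 / real q) *\<^sub>R (x - \<epsilon> *\<^sub>R v) \<in> alcove \<longleftrightarrow> (\<forall>i\<le>DIM('a). wall q i x \<ge> real (ascent w i))"
proof -
  have "aeval (affine_simple i) ((1 / real q) *\<^sub>R (x - \<epsilon> *\<^sub>R v)) > 0 \<longleftrightarrow> wall q i x \<ge> real (ascent w i)"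
    if i: "i \<le> DIM('a)" for i
  proof -
    let ?\<beta> = "w (\<alpha> i)"
    have b: "?\<beta> \<in> \<Phi>" using weyl_root w simple_root i by blast
    have "real q * aeval (affine_simple i) ((1 / real q) *\<^sub>R (x - \<epsilon> *\<^sub>R v)) = wall q i x - \<epsilon> * (\<alpha> i \<bullet> v)"
      using \<open>q > 0\<close> by (simp add: aeval_def affine_simple_def wall_def field_simps inner_diff_right)
    also have "\<alpha> i \<bullet> v = ?\<beta> \<bullet> \<rho>"
      using inner_weyl[OF w, of "\<alpha> i" v] v by simp
    finally have "aeval (affine_simple i) ((1 / real q) *\<^sub>R (x - \<epsilon> *\<^sub>R v)) > 0 \<longleftrightarrow> wall q i x - \<epsilon> * (?\<beta> \<bullet> \<rho>) > 0"
      using \<open>q > 0\<close> by (metis of_nat_0_less_iff zero_less_mult_pos mult_pos_pos)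
    also have "\<dots> \<longleftrightarrow> wall q i x \<ge> (if \<epsilon> * (?\<beta> \<bullet> \<rho>) > 0 then 1 else 0)"
      using wall_Ints[OF x i] eps b inner_rho(1)[OF b] by (intro int_real_between) auto
    also have "(if \<epsilon> * (?\<beta> \<bullet> \<rho>) > 0 then 1 else 0) = real (ascent w i)"
      using eps(1) inner_rho(2)[OF b] by (simp add: ascent_def zero_less_mult_iff)
    finally show ?thesis .
  qed
  then show ?thesis unfolding alcove_def by blast
qed

text \<open>Scaling the perturbed point by 1 / q turns translations from q Q into translations from
  Q; existence and uniqueness are then the two halves of simple transitivity on alcoves.\<close>

lemma marked_point_unique:
  assumes q: "q > 0" and z: "z \<in> coweight_lattice \<alpha>"
  shows "\<exists>!p. p \<in> marked_points q \<and> z - fst p (snd p) \<in> (\<lambda>l. real q *\<^sub>R l) ` coroot_lattice \<Phi>"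
proof -
  obtain \<epsilon> where eps: "\<epsilon> > 0" "\<forall>\<beta>\<in>\<Phi>. \<bar>\<epsilon> * (\<beta> \<bullet> \<rho>)\<bar> < 1" using small_rho_exists by blast
  define y where "y = (1 / real q) *\<^sub>R (z - \<epsilon> *\<^sub>R \<rho>)"
  \<comment> \<open>A zero would equate an integer with \<epsilon> times the height of a root, which
    is nonzero and less than 1 in absolute value.\<close>
  have "aeval a y \<noteq> 0" if a: "a \<in> affine_roots" for a
  proof
    assume "aeval a y = 0"
    then have "fst a \<bullet> z + real q * snd a = \<epsilon> * (fst a \<bullet> \<rho>)"
      using q by (simp add: aeval_def y_def field_simps inner_diff_right)
    moreover have "fst a \<bullet> z + real q * snd a \<in> \<int>" "fst a \<in> \<Phi>"
      using a coweight_inner_root[OF z] unfolding affine_roots_def by auto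
    ultimately show False
      using eps inner_rho(1)[of "fst a"] Ints_nonzero_abs_less1[of "\<epsilon> * (fst a \<bullet> \<rho>)"] by auto
  qed
  then obtain w l x' where w: "w \<in> weyl_group \<Phi>" and l: "l \<in> coroot_lattice \<Phi>" and x': "x' \<in> alcove" "y = w x' + l"
    using regular_point_in_alcove_image by blast
  have preimage: "\<exists>v. w' v = u" if "w' \<in> weyl_group \<Phi>" for w' u
    using orthogonal_transformation_surj[OF weyl_orthogonal[OF that]] by (metis surj_def)
  obtain v where v: "w v = \<rho>" using preimage[OF w] by blast
  \<comment> \<open>Undoes the scaling and the perturbation, where v is \<rho> pulled back by w: the
    image of x is then z up to q Q, with no \<epsilon> left.\<close>
  define x where "x = real q *\<^sub>R x' + \<epsilon> *\<^sub>R v"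
  have "w x = real q *\<^sub>R w x' + \<epsilon> *\<^sub>R \<rho>"
    using weyl_linear[OF w] by (simp add: x_def linear_add linear_cmul v)
  also have "w x' = y - l" using x' by simp
  finally have wx: "w x = z - real q *\<^sub>R l"
    using q by (simp add: y_def algebra_simps)
  have x: "x \<in> coweight_lattice \<alpha>"
    using weyl_coweight_iff[OF w, of x] unfolding wx
    using coweight_diff[OF z coweight_scale] l coroot_lattice_subset by blast
  have "(1 / real q) *\<^sub>R (x - \<epsilon> *\<^sub>R v) = x'" using q by (simp add: x_def)
  then have m: "(w, x) \<in> marked_points q"
    using perturbed_in_alcove_iff[OF w x v q eps] w x x' unfolding marked_points_def by auto
  show ?thesis
  proof (rule ex1I[of _ "(w, x)"])
    show "(w, x) \<in> marked_points q \<and> z - fst (w, x) (snd (w, x)) \<in> (\<lambda>l. real q *\<^sub>R l) ` coroot_lattice \<Phi>"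
      using m wx imageI[OF l, of "\<lambda>l. real q *\<^sub>R l"] by simp
  next
    fix p assume p: "p \<in> marked_points q \<and> z - fst p (snd p) \<in> (\<lambda>l. real q *\<^sub>R l) ` coroot_lattice \<Phi>"
    obtain w1 x1 where p1: "p = (w1, x1)" by (cases p)
    then have w1: "w1 \<in> weyl_group \<Phi>" and x1: "x1 \<in> coweight_lattice \<alpha>"
      and w1_wall: "\<forall>i\<le>DIM('a). wall q i x1 \<ge> real (ascent w1 i)"
      using p unfolding marked_points_def by auto
    obtain l1 where l1: "l1 \<in> coroot_lattice \<Phi>" "z - w1 x1 = real q *\<^sub>R l1"
      using p p1 by auto
    obtain v1 where v1: "w1 v1 = \<rho>" using preimage[OF w1] by blast
    have a1: "(1 / real q) *\<^sub>R (x1 - \<epsilon> *\<^sub>R v1) \<in> alcove"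
      using perturbed_in_alcove_iff[OF w1 x1 v1 q eps] w1_wall by blast
    have "w1 ((1 / real q) *\<^sub>R (x1 - \<epsilon> *\<^sub>R v1)) = (1 / real q) *\<^sub>R (w1 x1 - \<epsilon> *\<^sub>R \<rho>)"
      using weyl_linear[OF w1] by (simp add: linear_diff linear_cmul v1)
    also have "w1 x1 = z - real q *\<^sub>R l1" using l1(2) by (simp add: algebra_simps)
    also have "(1 / real q) *\<^sub>R (z - real q *\<^sub>R l1 - \<epsilon> *\<^sub>R \<rho>) = y - l1"
      using q by (simp add: y_def algebra_simps)
    finally have "w1 ((1 / real q) *\<^sub>R (x1 - \<epsilon> *\<^sub>R v1)) + l1 = w x' + l" using x' by simp
    then have "w1 = w" "l1 = l"
      using alcove_image_unique[OF w1 l1(1) a1 w l x'(1)] by auto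
    then have "w x1 = w x" using l1(2) wx by (simp add: algebra_simps)
    then have "x1 = x" using orthogonal_transformation_inj[OF weyl_orthogonal[OF w]] by (simp add: inj_eq)
    with \<open>w1 = w\<close> show "p = (w, x)" using p1 by simp
  qed
qed

text \<open>The coordinates are the wall values lowered by b i. Coordinate 0 is lost in
  \<open>simple_dual\<close>, but the weighted sum recovers it since c 0 = 1.\<close>

lemma bij_betw_points_partitions:
  assumes "(\<Sum>i\<le>DIM('a). c i * b i) \<le> q"
  shows "bij_betw (\<lambda>y. simple_dual (\<lambda>i. real (y i + b i)))
    (partitions_with_weights c DIM('a) (q - (\<Sum>i\<le>DIM('a). c i * b i)))
    {x \<in> coweight_lattice \<alpha>. \<forall>i\<le>DIM('a). wall q i x \<ge> real (b i)}"
    (is "bij_betw ?F ?P ?X")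
proof (rule bij_betwI')
  have split: "(\<Sum>i\<le>DIM('a). c i * y i) = y 0 + (\<Sum>i=1..DIM('a). c i * y i)" for y :: "nat \<Rightarrow> nat"
    unfolding atMost_DIM by (simp add: c_0)
  {
    fix y y' assume y: "y \<in> ?P" "y' \<in> ?P"
    show "?F y = ?F y' \<longleftrightarrow> y = y'"
    proof
      assume eq: "?F y = ?F y'"
      have i: "y i = y' i" if "i \<in> {1..DIM('a)}" for i
        using arg_cong[OF eq, of "\<lambda>x. \<alpha> i \<bullet> x"] that by (simp add: inner_simple_dual)
      moreover have "y 0 = y' 0"
        using y i unfolding partitions_with_weights_def split by simp
      moreover have "y i = y' i" if "i > DIM('a)" for i
        using y that unfolding partitions_with_weights_def by simp
      ultimately show "y = y'"
        by (metis atLeastAtMost_iff ext less_one not_le)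
    qed simp
  next
    fix y assume y: "y \<in> ?P"
    then have s: "(\<Sum>i\<le>DIM('a). c i * (y i + b i)) = q"
      using assms by (simp add: partitions_with_weights_def sum.distrib distrib_left)
    have "wall q i (?F y) = real (y i + b i)" if "i \<le> DIM('a)" for i
    proof (cases "i = 0")
      case True
      have "wall q 0 (?F y) = real q - (\<Sum>i=1..DIM('a). real (c i) * real (y i + b i))"
        by (simp only: wall_def alpha_0 highest_eq inner_minus_left inner_comb_simple_dual) simp
      also have "\<dots> = real (y 0 + b 0)"
        unfolding s [symmetric] split by simp
      finally show ?thesis using True by simp
    qed (use that in \<open>simp add: wall_def inner_simple_dual\<close>)
    then show "?F y \<in> ?X"
      using simple_dual_coweight[of "\<lambda>i. y i + b i"] by auto
  next
    fix x assume x: "x \<in> ?X"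
    define m where "m i = nat \<lfloor>wall q i x\<rfloor>" for i
    have m: "wall q i x = real (m i)" "m i \<ge> b i" if i: "i \<le> DIM('a)" for i
    proof -
      obtain k where k: "wall q i x = of_int k" using wall_Ints[of x i q] x i by (auto elim: Ints_cases)
      moreover have "of_int k \<ge> real (b i)" using x i k by auto
      then have "k \<ge> int (b i)" by linarith
      ultimately show "wall q i x = real (m i)" "m i \<ge> b i" unfolding m_def by auto
    qed
    have "real (\<Sum>i\<le>DIM('a). c i * m i) = real q"
      using sum_c_wall[of q x] m by simp
    then have sm: "(\<Sum>i\<le>DIM('a). c i * m i) = q" by linarith
    define y where "y i = (if i \<le> DIM('a) then m i - b i else 0)" for i
    have "(\<Sum>i\<le>DIM('a). c i * y i) + (\<Sum>i\<le>DIM('a). c i * b i) = q"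
      unfolding sm [symmetric] sum.distrib [symmetric] using m(2)
      by (intro sum.cong) (auto simp: y_def distrib_left [symmetric])
    then have "y \<in> ?P" unfolding partitions_with_weights_def by (auto simp: y_def)
    moreover have "x = ?F y"
    proof (rule eq_if_inner_simple_eq)
      fix i assume i: "i \<in> {1..DIM('a)}"
      then show "\<alpha> i \<bullet> x = \<alpha> i \<bullet> ?F y"
        using m[of i] by (simp add: inner_simple_dual y_def wall_def)
    qed
    ultimately show "\<exists>y\<in>?P. x = ?F y" by blast
  }
qed

lemma finite_marked_points: "finite (marked_points q)"
  unfolding marked_points_def
proof (rule finite_SigmaI[OF finite_weyl_group])
  fix w
  have "finite {x \<in> coweight_lattice \<alpha>. \<forall>i\<le>DIM('a). wall q i x \<ge> real ((\<lambda>_. 0) i)}"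
    using bij_betw_finite[OF bij_betw_points_partitions[of "\<lambda>_. 0" q]]
      finite_partitions_with_weights[of "DIM('a)" c] c_pos by auto
  then show "finite {x \<in> coweight_lattice \<alpha>. \<forall>i\<le>DIM('a). wall q i x \<ge> real (ascent w i)}"
    by (rule rev_finite_subset) (auto intro: order_trans[OF of_nat_0_le_iff])
qed

lemma card_marked_points:
  assumes "\<And>w. w \<in> weyl_group \<Phi> \<Longrightarrow> asc \<Phi> \<alpha> c w \<le> q"
  shows "card (marked_points q) =
    (\<Sum>w\<in>weyl_group \<Phi>. card (partitions_with_weights c DIM('a) (q - asc \<Phi> \<alpha> c w)))"
proof -
  have f: "finite {x \<in> coweight_lattice \<alpha>. \<forall>i\<le>DIM('a). wall q i x \<ge> real (ascent w i)}"
    if "w \<in> weyl_group \<Phi>" for w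
  proof (rule finite_subset)
    show "{x \<in> coweight_lattice \<alpha>. \<forall>i\<le>DIM('a). wall q i x \<ge> real (ascent w i)} \<subseteq> snd ` marked_points q"
      using that unfolding marked_points_def by force
  qed (simp add: finite_marked_points)
  have "card (marked_points q) =
      (\<Sum>w\<in>weyl_group \<Phi>. card {x \<in> coweight_lattice \<alpha>. \<forall>i\<le>DIM('a). wall q i x \<ge> real (ascent w i)})"
    unfolding marked_points_def using finite_weyl_group f by (intro card_SigmaI) auto
  also have "\<dots> = (\<Sum>w\<in>weyl_group \<Phi>. card (partitions_with_weights c DIM('a) (q - asc \<Phi> \<alpha> c w)))"
    using bij_betw_same_card[OF bij_betw_points_partitions[of "ascent w" q for w]] assms
    unfolding asc_eq by (intro sum.cong) auto
  finally show ?thesis .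
qed

section \<open>The index of q Q in Z\<close>

abbreviation marked_value :: "('a \<Rightarrow> 'a) \<times> 'a \<Rightarrow> 'a" where
  "marked_value p \<equiv> fst p (snd p)"

lemma marked_value_coweight: "p \<in> marked_points q \<Longrightarrow> marked_value p \<in> coweight_lattice \<alpha>"
  using weyl_coweight_iff unfolding marked_points_def by auto

text \<open>As \<open>card\<close> is 0 on infinite sets, the bijection with the finite set of
  marked points for q = 1 is what makes the index a genuine count.\<close>

lemma connection_index_eq: "connection_index \<Phi> \<alpha> = card (marked_points 1)"
proof -
  have "bij_betw (\<lambda>p. {(x, y). x \<in> coweight_lattice \<alpha> \<and> y \<in> coweight_lattice \<alpha> \<and> x - y \<in> coroot_lattice \<Phi>}
        `` {marked_value p}) (marked_points 1)
      (coweight_lattice \<alpha> // {(x, y). x \<in> coweight_lattice \<alpha> \<and> y \<in> coweight_lattice \<alpha> \<and> x - y \<in> coroot_lattice \<Phi>})"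
    using marked_point_unique[of 1]
    by (intro bij_betw_quotient_representatives coroot_lattice_0 coroot_lattice_diff marked_value_coweight) auto
  from bij_betw_same_card[OF this] show ?thesis unfolding connection_index_def by simp
qed

lemma connection_index_pos: "connection_index \<Phi> \<alpha> > 0"
proof -
  have "marked_points 1 \<noteq> {}" using marked_point_unique[of 1 0] coweight_0 by auto
  then show ?thesis unfolding connection_index_eq using finite_marked_points by (simp add: card_gt_0_iff)
qed

text \<open>Two transversals of Z / q Q are compared: the marked points for q, and a box of
  representatives of Z / q Z combined with q times the marked points for 1, which represent q Z / q
  Q.\<close>

lemma card_marked_points_eq:
  assumes q: "q > 0"
  shows "card (marked_points q) = q ^ DIM('a) * connection_index \<Phi> \<alpha>"
proof -
  let ?L = "(\<lambda>l. real q *\<^sub>R l) ` coroot_lattice \<Phi>"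
  let ?T = "{1..DIM('a)} \<rightarrow>\<^sub>E {..<q}"
  let ?F = "\<lambda>(t, p). simple_dual (\<lambda>i. real (t i)) + real q *\<^sub>R marked_value p"
  define R where "R = {(x, y). x \<in> coweight_lattice \<alpha> \<and> y \<in> coweight_lattice \<alpha> \<and> x - y \<in> ?L}"
  have L0: "0 \<in> ?L" using coroot_lattice_0 by (intro image_eqI[of _ _ 0]) auto
  have Ldiff: "x - y \<in> ?L" if "x \<in> ?L" "y \<in> ?L" for x y
  proof -
    obtain l l' where "x = real q *\<^sub>R l" "y = real q *\<^sub>R l'" "l \<in> coroot_lattice \<Phi>" "l' \<in> coroot_lattice \<Phi>"
      using \<open>x \<in> ?L\<close> \<open>y \<in> ?L\<close> by blast
    then show ?thesis
      using coroot_lattice_diff[of l l'] by (intro image_eqI[of _ _ "l - l'"]) (auto simp: scaleR_diff_right)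
  qed
  have "bij_betw (\<lambda>p. R `` {marked_value p}) (marked_points q) (coweight_lattice \<alpha> // R)"
    unfolding R_def using marked_point_unique[OF q]
    by (intro bij_betw_quotient_representatives L0 Ldiff marked_value_coweight) auto
  then have card_q: "card (marked_points q) = card (coweight_lattice \<alpha> // R)"
    by (rule bij_betw_same_card)
  have "bij_betw (\<lambda>p. R `` {?F p}) (?T \<times> marked_points 1) (coweight_lattice \<alpha> // R)"
    unfolding R_def
  proof (rule bij_betw_quotient_representatives[OF L0 Ldiff])
    fix p assume "p \<in> ?T \<times> marked_points 1"
    then show "?F p \<in> coweight_lattice \<alpha>"
      by (auto intro!: coweight_add simple_dual_coweight coweight_scale marked_value_coweight)
  next
    fix z assume z: "z \<in> coweight_lattice \<alpha>"
    define k where "k i = \<lfloor>\<alpha> i \<bullet> z\<rfloor>" for i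
    have k: "\<alpha> i \<bullet> z = of_int (k i)" if "i \<in> {1..DIM('a)}" for i
      using z that unfolding coweight_lattice_def k_def by simp
    \<comment> \<open>Division with remainder by q in each coordinate: t holds the remainders and z'
      the quotients.\<close>
    define t where "t = (\<lambda>i\<in>{1..DIM('a)}. nat (k i mod int q))"
    have t: "t \<in> ?T" using q by (auto simp: t_def nat_less_iff)
    define z' where "z' = (1 / real q) *\<^sub>R (z - simple_dual (\<lambda>i. real (t i)))"
    have zz': "z = simple_dual (\<lambda>i. real (t i)) + real q *\<^sub>R z'" using q by (simp add: z'_def)
    have "\<alpha> i \<bullet> z' = of_int (k i div int q)" if i: "i \<in> {1..DIM('a)}" for i
    proof -
      have "real q * (\<alpha> i \<bullet> z') = of_int (k i - k i mod int q)"
        using q i by (simp add: z'_def inner_diff_right inner_simple_dual k t_def)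
      also have "k i - k i mod int q = int q * (k i div int q)"
        by (simp add: minus_mod_eq_mult_div)
      finally show ?thesis using q by simp
    qed
    then have z': "z' \<in> coweight_lattice \<alpha>" unfolding coweight_lattice_def by auto
    have "\<exists>!p. p \<in> marked_points 1 \<and> z' - marked_value p \<in> coroot_lattice \<Phi>"
      using marked_point_unique[of 1, OF _ z'] by simp
    then obtain p where p: "p \<in> marked_points 1" "z' - marked_value p \<in> coroot_lattice \<Phi>"
      and p_unique: "\<And>p'. p' \<in> marked_points 1 \<Longrightarrow> z' - marked_value p' \<in> coroot_lattice \<Phi> \<Longrightarrow> p' = p"
      by (elim ex1E) blast
    show "\<exists>!p. p \<in> ?T \<times> marked_points 1 \<and> z - ?F p \<in> ?L"
    proof (rule ex1I[of _ "(t, p)"])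
      have "z - ?F (t, p) = real q *\<^sub>R (z' - marked_value p)"
        by (simp add: zz' algebra_simps)
      then show "(t, p) \<in> ?T \<times> marked_points 1 \<and> z - ?F (t, p) \<in> ?L"
        using t p by blast
    next
      fix tp assume tp: "tp \<in> ?T \<times> marked_points 1 \<and> z - ?F tp \<in> ?L"
      obtain t1 p1 where eq: "tp = (t1, p1)" by (cases tp)
      then have t1: "t1 \<in> ?T" and p1: "p1 \<in> marked_points 1" using tp by auto
      obtain l where l: "l \<in> coroot_lattice \<Phi>"
        "z = simple_dual (\<lambda>i. real (t1 i)) + real q *\<^sub>R (marked_value p1 + l)"
        using tp eq by (auto simp: algebra_simps)
      have "t1 i = t i" if i: "i \<in> {1..DIM('a)}" for i
      proof -
        have "marked_value p1 + l \<in> coweight_lattice \<alpha>"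
          using coweight_add marked_value_coweight[OF p1] l(1) coroot_lattice_subset by blast
        then have "\<alpha> i \<bullet> (marked_value p1 + l) \<in> \<int>"
          using i unfolding coweight_lattice_def by blast
        then obtain n where n: "\<alpha> i \<bullet> (marked_value p1 + l) = of_int n"
          by (rule Ints_cases)
        have "real_of_int (k i) = real (t1 i) + real q * of_int n"
          using l(2) n by (simp add: k[OF i, symmetric] inner_add_right inner_simple_dual[OF i])
        then have "k i = int (t1 i) + int q * n"
          by (metis of_int_add of_int_eq_iff of_int_mult of_int_of_nat_eq)
        \<comment> \<open>This bound makes t1 i the remainder of k i modulo q, hence equal to t
          i.\<close>
        moreover have "t1 i < q" using t1 i by auto
        ultimately show ?thesis using i by (simp add: t_def)
      qed
      then have "t1 = t" using t1 t by (intro PiE_ext) auto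
      with l(2) zz' have "real q *\<^sub>R z' = real q *\<^sub>R (marked_value p1 + l)" by simp
      then have "z' = marked_value p1 + l" using q by simp
      then have "p1 = p" using p_unique[OF p1] l(1) by simp
      with \<open>t1 = t\<close> eq show "tp = (t, p)" by simp
    qed
  qed
  then have "card (?T \<times> marked_points 1) = card (coweight_lattice \<alpha> // R)"
    by (rule bij_betw_same_card)
  then show ?thesis
    unfolding card_q by (simp add: card_cartesian_product card_PiE connection_index_eq)
qed

end

section \<open>The Worpitzky identity\<close>

text \<open>A summation bound above the degree lets polynomials of different degrees be added term
  by term.\<close>

lemma shift_apply_eq:
  assumes "degree p \<le> N"
  shows "shift_apply p g t = (\<Sum>k\<le>N. coeff p k * g (t - int k))"
  unfolding shift_apply_def using assms
  by (intro sum.mono_neutral_left) (auto simp: coeff_eq_0)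

lemma shift_apply_smult: "shift_apply (smult a p) g t = a * shift_apply p g t"
  using shift_apply_eq[of "smult a p" "degree p" g t] shift_apply_eq[of p "degree p" g t]
  by (simp add: degree_smult_le sum_distrib_left mult.assoc)

lemma shift_apply_add: "shift_apply (p + r) g t = shift_apply p g t + shift_apply r g t"
proof -
  let ?N = "max (degree p) (degree r)"
  show ?thesis
    using shift_apply_eq[of "p + r" ?N g t] shift_apply_eq[of p ?N g t] shift_apply_eq[of r ?N g t]
    by (simp add: degree_add_le_max sum.distrib distrib_right)
qed

lemma shift_apply_sum: "shift_apply (\<Sum>i\<in>A. p i) g t = (\<Sum>i\<in>A. shift_apply (p i) g t)"
  by (induction A rule: infinite_finite_induct) (simp_all add: shift_apply_add, simp_all add: shift_apply_def)

lemma shift_apply_monom: "shift_apply (monom 1 k) g t = g (t - int k)"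
proof -
  have "shift_apply (monom 1 k) g t = (\<Sum>j\<le>k. if k = j then g (t - int j) else 0)"
    unfolding shift_apply_eq[OF degree_monom_le] by (intro sum.cong) auto
  then show ?thesis by simp
qed

lemma shift_apply_eulerian_poly:
  "shift_apply (eulerian_poly \<Phi> \<alpha> c) g t =
    1 / real (connection_index \<Phi> \<alpha>) * (\<Sum>w\<in>weyl_group \<Phi>. g (t - int (asc \<Phi> \<alpha> c w)))"
  unfolding eulerian_poly_def shift_apply_smult shift_apply_sum shift_apply_monom ..

section \<open>The Ehrhart quasi-polynomial of the closed alcove, and the identity\<close>

context based_root_system
begin

lemma fundamental_alcove_eq: "fundamental_alcove \<alpha> \<theta> = alcove"
  unfolding fundamental_alcove_def alcove_def
proof (intro Collect_cong iffI)
  fix x assume *: "(\<forall>i\<in>{1..DIM('a)}. \<alpha> i \<bullet> x > 0) \<and> \<theta> \<bullet> x < 1"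
  show "\<forall>i\<le>DIM('a). aeval (affine_simple i) x > 0"
  proof clarify
    fix i assume "i \<le> DIM('a)"
    with * show "aeval (affine_simple i) x > 0"
      by (cases "i = 0") (simp_all add: aeval_def affine_simple_def alpha_0)
  qed
next
  fix x assume *: "\<forall>i\<le>DIM('a). aeval (affine_simple i) x > 0"
  show "(\<forall>i\<in>{1..DIM('a)}. \<alpha> i \<bullet> x > 0) \<and> \<theta> \<bullet> x < 1"
  proof (intro conjI ballI)
    fix i assume "i \<in> {1..DIM('a)}"
    with * show "\<alpha> i \<bullet> x > 0" by (auto simp: aeval_def affine_simple_def dest!: spec[of _ i])
  next
    show "\<theta> \<bullet> x < 1" using *[rule_format, of 0] by (simp add: aeval_def affine_simple_def alpha_0)
  qed
qed

text \<open>The right-hand side is closed, and each of its points is the limit of points on the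
  segment to a fixed point u of the alcove. This uses that the alcove is nonempty.\<close>

lemma closure_alcove: "closure alcove = {x. \<forall>i\<le>DIM('a). aeval (affine_simple i) x \<ge> 0}" (is "_ = ?C")
proof
  have C: "?C = (\<Inter>i\<in>{..DIM('a)}. {x. aeval (affine_simple i) x \<ge> 0})" by auto
  have "closed ?C"
    unfolding C
  proof (intro closed_INT ballI)
    show "closed {x. aeval (affine_simple i) x \<ge> 0}" for i
      unfolding aeval_def by (intro closed_Collect_le continuous_intros)
  qed
  then show "closure alcove \<subseteq> ?C"
    by (rule closure_minimal[rotated]) (auto simp: alcove_def less_imp_le)
  show "?C \<subseteq> closure alcove"
  proof
    fix x assume x: "x \<in> ?C"
    obtain u where u: "u \<in> alcove" using alcove_nonempty by blast
    define s where "s n = x + (1 / real (Suc n)) *\<^sub>R (u - x)" for n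
    have "s n \<in> alcove" for n
    proof -
      have "aeval (affine_simple i) (s n) > 0" if i: "i \<le> DIM('a)" for i
      proof -
        have "aeval (affine_simple i) (s n) =
            (1 - 1 / real (Suc n)) * aeval (affine_simple i) x + 1 / real (Suc n) * aeval (affine_simple i) u"
          by (simp add: s_def aeval_def algebra_simps add_divide_distrib diff_divide_distrib inner_diff_right)
        also have "\<dots> > 0"
          using x u i unfolding alcove_def by (intro add_nonneg_pos mult_nonneg_nonneg mult_pos_pos) auto
        finally show ?thesis .
      qed
      then show ?thesis unfolding alcove_def by blast
    qed
    moreover have "s \<longlonglongrightarrow> x + 0 *\<^sub>R (u - x)"
      unfolding s_def using lim_inverse_n'[THEN LIMSEQ_Suc] by (intro tendsto_intros) simp
    ultimately show "x \<in> closure alcove" unfolding closure_sequential by auto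
  qed
qed

lemma dilated_alcove_points:
  assumes "q > 0"
  shows "(\<lambda>x. real q *\<^sub>R x) ` closure (fundamental_alcove \<alpha> \<theta>) \<inter> coweight_lattice \<alpha> =
    {x \<in> coweight_lattice \<alpha>. \<forall>i\<le>DIM('a). wall q i x \<ge> real 0}"
proof -
  have wall: "wall q i (real q *\<^sub>R x) = real q * aeval (affine_simple i) x" for i x
    by (simp add: wall_def aeval_def affine_simple_def algebra_simps)
  have "x \<in> (\<lambda>x. real q *\<^sub>R x) ` closure alcove \<longleftrightarrow> (\<forall>i\<le>DIM('a). wall q i x \<ge> 0)" for x
  proof
    assume "x \<in> (\<lambda>x. real q *\<^sub>R x) ` closure alcove"
    then show "\<forall>i\<le>DIM('a). wall q i x \<ge> 0" unfolding closure_alcove by (auto simp: wall)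
  next
    assume *: "\<forall>i\<le>DIM('a). wall q i x \<ge> 0"
    have x: "x = real q *\<^sub>R ((1 / real q) *\<^sub>R x)" using assms by simp
    have "\<forall>i\<le>DIM('a). aeval (affine_simple i) ((1 / real q) *\<^sub>R x) \<ge> 0"
    proof clarify
      fix i assume i: "i \<le> DIM('a)"
      have "real q * aeval (affine_simple i) ((1 / real q) *\<^sub>R x) \<ge> 0"
        using * i unfolding wall [symmetric] x [symmetric] by blast
      then show "aeval (affine_simple i) ((1 / real q) *\<^sub>R x) \<ge> 0"
        using assms by (simp add: zero_le_mult_iff)
    qed
    with x show "x \<in> (\<lambda>x. real q *\<^sub>R x) ` closure alcove" unfolding closure_alcove by blast
  qed
  then show ?thesis unfolding fundamental_alcove_eq by auto
qed

text \<open>The definite description is resolved by the partition count K: it counts the points of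
  the dilates, and a quasi-polynomial is determined by its values from 1 on.\<close>

lemma ehrhart_alcove:
  defines "L \<equiv> ehrhart_quasi_polynomial (closure (fundamental_alcove \<alpha> \<theta>)) (coweight_lattice \<alpha>)"
  shows "quasi_polynomial L" and "q > 0 \<Longrightarrow> L (int q) = real (card (partitions_with_weights c DIM('a) q))"
proof -
  obtain K where K: "quasi_polynomial K" "\<And>q. K (int q) = real (card (partitions_with_weights c DIM('a) q))"
    using quasi_polynomial_card_partitions_with_weights[of c "DIM('a)"] c_0 c_pos by blast
  have K_count: "K (int q) = real (card ((\<lambda>x. real q *\<^sub>R x) ` closure (fundamental_alcove \<alpha> \<theta>) \<inter> coweight_lattice \<alpha>))"
    if "q > 0" for q
    using bij_betw_same_card[OF bij_betw_points_partitions[of "\<lambda>_. 0" q]]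
    unfolding dilated_alcove_points[OF that] K(2) by simp
  have "L = K"
    unfolding L_def ehrhart_quasi_polynomial_def
  proof (rule the_equality)
    fix L' assume L': "quasi_polynomial L' \<and> (\<forall>q::nat. q > 0 \<longrightarrow> L' (int q) =
      real (card ((\<lambda>x. real q *\<^sub>R x) ` closure (fundamental_alcove \<alpha> \<theta>) \<inter> coweight_lattice \<alpha>)))"
    show "L' = K"
    proof (rule quasi_polynomial_eqI[of _ _ 1])
      fix t :: int assume "t \<ge> 1"
      then obtain q where "t = int q" "q > 0" by (metis zero_less_imp_eq_int int_one_le_iff_zero_less)
      then show "L' t = K t" using L' K_count by simp
    qed (use L' K(1) in auto)
  qed (use K(1) K_count in auto)
  then show "quasi_polynomial L" "q > 0 \<Longrightarrow> L (int q) = real (card (partitions_with_weights c DIM('a) q))"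
    using K by auto
qed

theorem worpitzky_identity:
  "real_of_int q ^ DIM('a) = shift_apply (eulerian_poly \<Phi> \<alpha> c)
    (ehrhart_quasi_polynomial (closure (fundamental_alcove \<alpha> \<theta>)) (coweight_lattice \<alpha>)) q"
proof -
  let ?L = "ehrhart_quasi_polynomial (closure (fundamental_alcove \<alpha> \<theta>)) (coweight_lattice \<alpha>)"
  let ?f = "connection_index \<Phi> \<alpha>"
  \<comment> \<open>The sum of all weights bounds every asc w, since each w selects a subset of the
    indices.\<close>
  define h where "h = (\<Sum>i\<le>DIM('a). c i)"
  have asc_le: "asc \<Phi> \<alpha> c w \<le> h" for w
    unfolding asc_eq h_def by (intro sum_mono) (simp add: ascent_def)
  have "(\<lambda>t. real_of_int t ^ DIM('a)) =
      (\<lambda>t. 1 / real ?f * (\<Sum>w\<in>weyl_group \<Phi>. ?L (t - int (asc \<Phi> \<alpha> c w))))"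
  proof (rule quasi_polynomial_eqI)
    show "quasi_polynomial (\<lambda>t. real_of_int t ^ DIM('a))"
      using quasi_polynomial_poly[of "monom 1 DIM('a)"] by (simp add: poly_monom)
    show "quasi_polynomial (\<lambda>t. 1 / real ?f * (\<Sum>w\<in>weyl_group \<Phi>. ?L (t - int (asc \<Phi> \<alpha> c w))))"
      by (intro quasi_polynomial_cmult quasi_polynomial_sum quasi_polynomial_shift ehrhart_alcove)
  next
    \<comment> \<open>From h + 1 on, all differences n - asc w are at least 1, so they are not
      truncated and every value of L is a count of points.\<close>
    fix t :: int assume t: "t \<ge> int h + 1"
    define n where "n = nat t"
    have n: "t = int n" "n > h" using t unfolding n_def by auto
    have L: "?L (t - int (asc \<Phi> \<alpha> c w)) = real (card (partitions_with_weights c DIM('a) (n - asc \<Phi> \<alpha> c w)))" for w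
      using ehrhart_alcove(2)[of "n - asc \<Phi> \<alpha> c w"] asc_le[of w] n by (simp add: of_nat_diff)
    have "asc \<Phi> \<alpha> c w \<le> n" for w
      using asc_le[of w] n(2) by simp
    then have "(\<Sum>w\<in>weyl_group \<Phi>. ?L (t - int (asc \<Phi> \<alpha> c w))) = real (card (marked_points n))"
      unfolding L by (simp add: card_marked_points)
    also have "\<dots> = real n ^ DIM('a) * real ?f"
      using card_marked_points_eq[of n] n(2) by simp
    finally show "real_of_int t ^ DIM('a) = 1 / real ?f * (\<Sum>w\<in>weyl_group \<Phi>. ?L (t - int (asc \<Phi> \<alpha> c w)))"
      using connection_index_pos n(1) by simp
  qed
  from fun_cong[OF this, of q] show ?thesis
    unfolding shift_apply_eulerian_poly .
qed

end

theorem theorem4p8: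
  fixes \<Phi> :: "'a::euclidean_space set"
    and \<alpha> :: "nat \<Rightarrow> 'a" and c :: "nat \<Rightarrow> nat" and \<theta> :: 'a and q :: int
  assumes "irreducible_root_system \<Phi>"
    and "simple_roots \<Phi> \<alpha>"
    and "highest_root \<Phi> \<alpha> \<theta>"
    and "\<theta> = (\<Sum>i=1..DIM('a). real (c i) *\<^sub>R \<alpha> i)"
    and "\<alpha> 0 = - \<theta>" and "c 0 = 1"
    and "q > int (coxeter_number \<alpha>)"
  shows "real_of_int q ^ DIM('a) =
    shift_apply (eulerian_poly \<Phi> \<alpha> c)
      (ehrhart_quasi_polynomial (closure (fundamental_alcove \<alpha> \<theta>)) (coweight_lattice \<alpha>)) q"
proof -
  interpret based_root_system \<Phi> \<alpha> c \<theta>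
    using assms by unfold_locales (auto simp: irreducible_root_system_def)
  show ?thesis by (rule worpitzky_identity)
qed

end
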